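(* Let $q$ be a power of an odd prime, let $d\geq 2$ be an integer, let $t\in\mathbb{F}_q^{*}$ and let $\mathcal{A}\subseteq\mathbb{F}_q$. Then \[ N_d(\mathcal{A};t)=(1+o(1))\frac{|\mathcal{A}|^{d^2}}{q} \] provided $|\mathcal{A}|=\omega\left(q^{\frac{d}{2d-1}}+q^{\frac{d^2-d+4}{2(d^2-d+2)}}\right)$.
   Context: $\mathbb{F}_q$ is the finite field with $q$ elements. For a set $\mathcal{A}\subseteq\mathbb{F}_q$ and $t\in\mathbb{F}_q$, $N_d(\mathcal{A};t)$ denotes the number of $d\times d$ matrices with all entries in $\mathcal{A}$ whose determinant equals $t$. Asymptotic notation refers to $q\to\infty$ with $d$ fixed; implied constants may depend on $d$. $U=O(V)$ means $|U|\le cV$ for some constant $c>0$; $U=\Omega(V)$ means $U\ge c|V|$ for some constant $c>0$; $U=\omega(V)$ means $U=\Omega(V)$ but not $U=O(V)$, i.e. $U/V\to\infty$; $o(1)$ denotes a quantity tending to $0$. *)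

theory Defs
  imports
    Complex_Main
    "HOL-Library.Landau_Symbols"
    "HOL-Combinatorics.Permutations"
    "HOL-Computational_Algebra.Primes"
    "HOL-Algebra.Coset"
    "HOL-Algebra.Ring"
    "Jordan_Normal_Form.Matrix"
begin

text \<open>
  The fields are HOL-Algebra records, because the asymptotic statement involves infinitely many
  finite fields of different characteristics, which no single type of class \<open>field\<close> can provide.
  Existing library determinants need a ring type class, so the Leibniz formula is
  given here over a record. The multiple \<open>[sign p] \<cdot> x\<close> is \<open>x\<close> or \<open>\<ominus> x\<close>.
\<close>

definition det_ring :: "('a, 'b) ring_scheme \<Rightarrow> 'a mat \<Rightarrow> 'a" where
  "det_ring R M =
     (\<Oplus>\<^bsub>R\<^esub> p \<in> {p. p permutes {0..<dim_row M}}.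
        [sign p] \<cdot>\<^bsub>R\<^esub> (\<Otimes>\<^bsub>R\<^esub> i \<in> {0..<dim_row M}. M $$ (i, p i)))"

definition det_count :: "('a, 'b) ring_scheme \<Rightarrow> nat \<Rightarrow> 'a set \<Rightarrow> 'a \<Rightarrow> nat" where
  "det_count R d A t =
     card {M \<in> carrier_mat d d. elements_mat M \<subseteq> A \<and> det_ring R M = t}"

end

theory Submission
  imports Defs
begin

text \<open>
  Write \<open>a = |A|\<close>. Expanding along the first row, the number of matrices with determinant \<open>t\<close> is the
  sum, over the choices of the other \<open>d - 1\<close> rows, of the number of \<open>y\<close> in \<open>A\<^sup>d\<close> with
  \<open>m \<cdot> y = t\<close>, where \<open>m\<close> is the vector of cofactors of the first row. The error is thus the sum of
  the deviations \<open>dev m t\<close> of these numbers from \<open>a\<^sup>d / q\<close>. The rows for which some cofactor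
  vanishes are few. For the others, Cauchy--Schwarz separates the second moment of \<open>dev m t\<close> over all
  \<open>m\<close> from that of the number of times a vector \<open>m\<close> arises. As the rows, and hence their number of
  choices, are constrained by orthogonality to \<open>m\<close>, the latter is controlled by the number of \<open>y\<close>
  in \<open>A\<^sup>d\<close> with \<open>m \<cdot> y = 0\<close>. The vectors \<open>m\<close> for which this number exceeds twice its expected
  value are handled by a moment of \<open>dev m 0\<close>, of order two if \<open>d = 3\<close> and of order \<open>2 (d - 2)\<close> if
  \<open>d\<close> is larger. All the moments rest on an exact formula for the average, over a new coefficient
  \<open>v\<close>, of the \<open>l\<^sup>2\<close> norm of the deviations.
\<close>

section \<open>Deviations of the number of solutions of a linear equation\<close>

text \<open>At a nonzero \<open>t\<close>, scaling equalises the second moments and gains a factor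
  of order \<open>q\<close>. At zero it gives nothing, as all multiples of \<open>m\<close> have the
  same solutions. This is the obstacle, since the number of matrices with cofactor vector
  \<open>m\<close> is bounded by a power of the count at zero. The same invariance is the remedy:
  the nonzero multiples of \<open>m\<close> share one orthogonal set while their matrices are
  disjoint, so that together they obey the trivial bound for a single one. The exponents force the
  order of the moment: Cauchy-Schwarz leaves the power \<open>d - 2\<close> of the count, the
  multiples add \<open>d - 1\<close>, and of these \<open>2 * d - 3\<close> factors one is estimated
  trivially. Up to constants, the square of the main relative error is
  \<open>q ^ 3 / a ^ (d + 2)\<close> from ordinary vectors and, from heavy ones,
  \<open>q ^ 5 / a ^ 8\<close> if \<open>d = 3\<close> and
  \<open>q ^ (2 * d) / a ^ (4 * d - 2)\<close> if \<open>d \<ge> 4\<close>. These match the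
  exponents of the hypothesis: the first is \<open>2 * d / (4 * d - 2)\<close>, the second is 3/4 at
  \<open>d = 2\<close> and 5/8 at \<open>d = 3\<close>.\<close>

lemma Cauchy_Schwarz_sum:
  fixes f g :: "'b \<Rightarrow> real"
  shows "(\<Sum>x\<in>S. f x * g x)\<^sup>2 \<le> (\<Sum>x\<in>S. (f x)\<^sup>2) * (\<Sum>x\<in>S. (g x)\<^sup>2)"
proof -
  \<comment> \<open>Lagrange's identity: this sum of squares is twice the difference of the two
    sides.\<close>
  have "0 \<le> (\<Sum>x\<in>S. \<Sum>y\<in>S. (f x * g y - f y * g x)\<^sup>2)"
    by (intro sum_nonneg) simp
  also have "\<dots> = (\<Sum>x\<in>S. \<Sum>y\<in>S. (f x)\<^sup>2 * (g y)\<^sup>2) + (\<Sum>x\<in>S. \<Sum>y\<in>S. (g x)\<^sup>2 * (f y)\<^sup>2)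
      - 2 * (\<Sum>x\<in>S. \<Sum>y\<in>S. (f x * g x) * (f y * g y))"
    by (simp add: power2_eq_square algebra_simps sum.distrib sum_subtractf sum_distrib_left)
  also have "(\<Sum>x\<in>S. \<Sum>y\<in>S. (g x)\<^sup>2 * (f y)\<^sup>2) = (\<Sum>x\<in>S. \<Sum>y\<in>S. (f x)\<^sup>2 * (g y)\<^sup>2)"
    by (subst sum.swap) (simp add: mult.commute)
  also have "(\<Sum>x\<in>S. \<Sum>y\<in>S. (f x)\<^sup>2 * (g y)\<^sup>2) = (\<Sum>x\<in>S. (f x)\<^sup>2) * (\<Sum>x\<in>S. (g x)\<^sup>2)"
    by (rule sum_product[symmetric])
  also have "(\<Sum>x\<in>S. \<Sum>y\<in>S. (f x * g x) * (f y * g y)) = (\<Sum>x\<in>S. f x * g x)\<^sup>2"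
    unfolding power2_eq_square by (rule sum_product[symmetric])
  finally show ?thesis by linarith
qed

lemma Cauchy_Schwarz_card:
  fixes f :: "'b \<Rightarrow> real"
  shows "(\<Sum>x\<in>S. f x)\<^sup>2 \<le> real (card S) * (\<Sum>x\<in>S. (f x)\<^sup>2)"
  using Cauchy_Schwarz_sum[of "\<lambda>_. 1" f S] by simp

lemma sum_swap_pair:
  "(\<Sum>x\<in>S. \<Sum>b\<in>B. \<Sum>c\<in>C. f x b c) = (\<Sum>b\<in>B. \<Sum>c\<in>C. \<Sum>x\<in>S. f x b c)"
  by (subst sum.swap) (intro sum.cong refl sum.swap)

section \<open>Sums over a finite field and the norm of the deviations\<close>

locale finite_field_subset = field R for R (structure) +
  fixes A :: "'a set"
  assumes finite_carrier: "finite (carrier R)"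
    and A_subset: "A \<subseteq> carrier R"
begin

definition q :: real where "q = real (card (carrier R))"

definition a :: real where "a = real (card A)"

text \<open>Coefficient vectors are lists, so that \<open>dev\<close> and the moments can be
  computed by recursion on the head coefficient.\<close>

definition vecs :: "nat \<Rightarrow> 'a list set" where
  "vecs n = {ms. set ms \<subseteq> carrier R \<and> length ms = n}"

declare finite_carrier [simp]

lemma finite_A [simp]: "finite A"
  using A_subset finite_carrier finite_subset by blast

lemma A_carrier [simp]: "x \<in> A \<Longrightarrow> x \<in> carrier R"
  using A_subset by blast

lemma q_ge_2: "q \<ge> 2"
proof -
  have "card {\<zero>, \<one>} \<le> card (carrier R)" by (intro card_mono) auto
  then show ?thesis by (simp add: q_def)
qed

lemma a_nonneg [simp]: "a \<ge> 0" by (simp add: a_def)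

lemma a_le_q: "a \<le> q"
  using card_mono[OF finite_carrier A_subset] by (simp add: a_def q_def)

lemma finite_vecs [simp]: "finite (vecs n)"
  unfolding vecs_def by (rule finite_lists_length_eq) simp

lemma vecs_0 [simp]: "vecs 0 = {[]}" by (auto simp: vecs_def)

lemma sum_vecs_Suc: "(\<Sum>ms\<in>vecs (Suc n). g ms) = (\<Sum>v\<in>carrier R. \<Sum>ms\<in>vecs n. g (v # ms))"
  for g :: "'a list \<Rightarrow> real"
proof -
  have "(\<Sum>v\<in>carrier R. \<Sum>ms\<in>vecs n. g (v # ms)) = (\<Sum>(v,ms)\<in>carrier R \<times> vecs n. g (v # ms))"
    by (simp add: sum.cartesian_product)
  also have "\<dots> = (\<Sum>ms\<in>vecs (Suc n). g ms)"
    by (rule sum.reindex_bij_witness[where i = "\<lambda>ms. (hd ms, tl ms)" and j = "\<lambda>(v,ms). v # ms"])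
       (auto simp: vecs_def length_Suc_conv)
  finally show ?thesis by simp
qed

lemma sum_translate: "c \<in> carrier R \<Longrightarrow> (\<Sum>x\<in>carrier R. g (x \<ominus> c)) = (\<Sum>x\<in>carrier R. g x)"
  for g :: "'a \<Rightarrow> real"
  by (rule sum.reindex_bij_witness[where i = "\<lambda>x. x \<oplus> c" and j = "\<lambda>x. x \<ominus> c"])
     (auto simp: a_minus_def a_assoc l_neg r_neg)

lemma sum_reflect: "c \<in> carrier R \<Longrightarrow> (\<Sum>x\<in>carrier R. g (c \<ominus> x)) = (\<Sum>x\<in>carrier R. g x)"
  for g :: "'a \<Rightarrow> real"
proof (rule sum.reindex_bij_witness[where i = "\<lambda>x. c \<ominus> x" and j = "\<lambda>x. c \<ominus> x"])
  fix x assume "c \<in> carrier R" "x \<in> carrier R"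
  then show "c \<ominus> (c \<ominus> x) = x" "c \<ominus> (c \<ominus> x) = x" by algebra+
qed auto

text \<open>As \<open>m\<close> is invertible, \<open>x\<close> goes to \<open>c + x m\<close>
  bijectively. This turns a sum over a new coefficient into a sum over all values of the
  form.\<close>

lemma sum_affine:
  fixes g :: "'a \<Rightarrow> real"
  assumes "c \<in> carrier R" "m \<in> carrier R" "m \<noteq> \<zero>"
  shows "(\<Sum>x\<in>carrier R. g (c \<oplus> x \<otimes> m)) = (\<Sum>x\<in>carrier R. g x)"
proof -
  have m: "m \<in> Units R" using assms by (simp add: field_Units)
  have "c \<oplus> (x \<ominus> c) \<otimes> inv m \<otimes> m = x" if "x \<in> carrier R" for x
    using that assms m by (simp add: m_assoc Units_l_inv) algebra
  moreover have "((c \<oplus> x \<otimes> m) \<ominus> c) \<otimes> inv m = x" if "x \<in> carrier R" for x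
  proof -
    have "((c \<oplus> x \<otimes> m) \<ominus> c) = x \<otimes> m" using that assms by algebra
    then show ?thesis using that assms m by (simp add: m_assoc Units_r_inv)
  qed
  ultimately show ?thesis using assms m
    by (intro sum.reindex_bij_witness[where i = "\<lambda>x. (x \<ominus> c) \<otimes> inv m" and j = "\<lambda>x. c \<oplus> x \<otimes> m"]) auto
qed

text \<open>If \<open>y\<close> ranges over vectors with entries in \<open>A\<close>, the number of solutions of
  \<open>m \<cdot> y = x\<close> is \<open>|A|^n / q + dev m x\<close>.\<close>

primrec dev :: "'a list \<Rightarrow> 'a \<Rightarrow> real" where
  "dev [] x = of_bool (x = \<zero>) - 1 / q"
| "dev (v # ms) x = (\<Sum>b\<in>A. dev ms (x \<ominus> v \<otimes> b))"

text \<open>The square of the l2 norm; no root is taken, so that its average over a new coefficient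
  is exact.\<close>

definition nrm :: "'a list \<Rightarrow> real" where
  "nrm ms = (\<Sum>x\<in>carrier R. (dev ms x)\<^sup>2)"

lemma nrm_nonneg [simp]: "nrm ms \<ge> 0"
  unfolding nrm_def by (intro sum_nonneg) simp

lemma dev_sq_le_nrm: "x \<in> carrier R \<Longrightarrow> (dev ms x)\<^sup>2 \<le> nrm ms"
  unfolding nrm_def by (rule member_le_sum) auto

lemma minus_eq_zero_iff: "x \<in> carrier R \<Longrightarrow> y \<in> carrier R \<Longrightarrow> x \<ominus> y = \<zero> \<longleftrightarrow> x = y"
proof
  assume C: "x \<in> carrier R" "y \<in> carrier R" and "x \<ominus> y = \<zero>"
  moreover have "x = (x \<ominus> y) \<oplus> y" using C by algebra
  ultimately show "x = y" by simp
qed (simp add: a_minus_def r_neg)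

lemma sum_dev_Nil: "(\<Sum>x\<in>carrier R. dev [] x) = 0"
proof -
  have "(\<Sum>x\<in>carrier R. dev [] x) = (\<Sum>x\<in>carrier R. (if x = \<zero> then 1 else 0)) - q * (1 / q)"
    by (simp add: sum_subtractf of_bool_def q_def)
  then show ?thesis using q_ge_2 by simp
qed

text \<open>The deviations are taken from the mean, and each \<open>y\<close> solves the equation
  for exactly one \<open>x\<close>. In the induction, every \<open>b\<close> in \<open>A\<close>
  merely translates the argument.\<close>

lemma sum_dev: "set ms \<subseteq> carrier R \<Longrightarrow> (\<Sum>x\<in>carrier R. dev ms x) = 0"
proof (induction ms)
  case Nil
  then show ?case by (simp only: sum_dev_Nil)
next
  case (Cons v ms)
  have "(\<Sum>x\<in>carrier R. dev (v # ms) x) = (\<Sum>b\<in>A. \<Sum>x\<in>carrier R. dev ms (x \<ominus> v \<otimes> b))"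
    by (simp add: sum.swap[of _ A])
  also have "\<dots> = 0" using Cons by (simp add: sum_translate)
  finally show ?case .
qed

text \<open>The new function is a sum of \<open>a\<close> translates of the old one, so
  Cauchy-Schwarz costs \<open>a\<close> twice. This holds for every single \<open>v\<close>; on
  average over \<open>v\<close>, \<open>sum_nrm_Cons\<close> loses only one factor
  \<open>a\<close>.\<close>

lemma nrm_Cons_le:
  assumes "v \<in> carrier R"
  shows "nrm (v # ms) \<le> a\<^sup>2 * nrm ms"
proof -
  have "nrm (v # ms) \<le> (\<Sum>x\<in>carrier R. a * (\<Sum>b\<in>A. (dev ms (x \<ominus> v \<otimes> b))\<^sup>2))"
    unfolding nrm_def a_def dev.simps by (intro sum_mono Cauchy_Schwarz_card)
  also have "\<dots> = a * (\<Sum>b\<in>A. \<Sum>x\<in>carrier R. (dev ms (x \<ominus> v \<otimes> b))\<^sup>2)"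
    by (simp add: sum_distrib_left[symmetric] sum.swap[of _ A])
  also have "\<dots> = a * (\<Sum>b\<in>A. nrm ms)"
    using assms by (simp add: sum_translate[of _ "\<lambda>x. (dev ms x)\<^sup>2"] nrm_def)
  finally show ?thesis by (simp add: a_def power2_eq_square)
qed

lemma nrm_append_le:
  "set xs \<subseteq> carrier R \<Longrightarrow> nrm (xs @ ys) \<le> a ^ (2 * length xs) * nrm ys"
proof (induction xs)
  case (Cons x xs)
  have "nrm (x # (xs @ ys)) \<le> a\<^sup>2 * nrm (xs @ ys)" using Cons by (intro nrm_Cons_le) auto
  also have "\<dots> \<le> a\<^sup>2 * (a ^ (2 * length xs) * nrm ys)" using Cons by (intro mult_left_mono) auto
  finally show ?case by (simp add: power2_eq_square mult.assoc)
qed simp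

text \<open>The average over the new coefficient \<open>v\<close> kills all off-diagonal terms, since \<open>dev ms\<close>
  sums to zero.\<close>

lemma sum_nrm_Cons:
  assumes "set ms \<subseteq> carrier R"
  shows "(\<Sum>v\<in>carrier R. nrm (v # ms)) = q * a * nrm ms"
proof -
  let ?K = "carrier R"
  define I where "I b b' = (\<Sum>v\<in>?K. \<Sum>x\<in>?K. dev ms (x \<ominus> v \<otimes> b) * dev ms (x \<ominus> v \<otimes> b'))" for b b'
  have I: "I b b' = (if b = b' then q * nrm ms else 0)" if "b \<in> A" "b' \<in> A" for b b'
  proof -
    have C: "b \<in> ?K" "b' \<in> ?K" using that by auto
    have "I b b' = (\<Sum>v\<in>?K. \<Sum>x\<in>?K. dev ms x * dev ms (x \<oplus> v \<otimes> (b \<ominus> b')))"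
      unfolding I_def
    proof (rule sum.cong[OF refl])
      fix v assume v: "v \<in> ?K"
      have "(\<Sum>x\<in>?K. dev ms (x \<ominus> v \<otimes> b) * dev ms (x \<ominus> v \<otimes> b'))
         = (\<Sum>x\<in>?K. dev ms (x \<ominus> v \<otimes> b) * dev ms ((x \<ominus> v \<otimes> b) \<oplus> v \<otimes> (b \<ominus> b')))"
      proof (rule sum.cong[OF refl])
        fix x assume "x \<in> ?K"
        then have "(x \<ominus> v \<otimes> b) \<oplus> v \<otimes> (b \<ominus> b') = x \<ominus> v \<otimes> b'" using v C by algebra
        then show "dev ms (x \<ominus> v \<otimes> b) * dev ms (x \<ominus> v \<otimes> b') = 
          dev ms (x \<ominus> v \<otimes> b) * dev ms ((x \<ominus> v \<otimes> b) \<oplus> v \<otimes> (b \<ominus> b'))" by simp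
      qed
      also have "\<dots> = (\<Sum>x\<in>?K. dev ms x * dev ms (x \<oplus> v \<otimes> (b \<ominus> b')))"
        using v C by (intro sum_translate[of _ "\<lambda>x. dev ms x * dev ms (x \<oplus> v \<otimes> (b \<ominus> b'))"]) auto
      finally show "(\<Sum>x\<in>?K. dev ms (x \<ominus> v \<otimes> b) * dev ms (x \<ominus> v \<otimes> b'))
         = (\<Sum>x\<in>?K. dev ms x * dev ms (x \<oplus> v \<otimes> (b \<ominus> b')))" .
    qed
    also have "\<dots> = (if b = b' then q * nrm ms else 0)"
    proof (cases "b = b'")
      case True
      then have "(\<Sum>v\<in>?K. \<Sum>x\<in>?K. dev ms x * dev ms (x \<oplus> v \<otimes> (b \<ominus> b'))) = (\<Sum>v\<in>?K. nrm ms)"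
        unfolding nrm_def using C by (intro sum.cong) (auto simp: a_minus_def r_neg power2_eq_square)
      then show ?thesis using True by (simp add: q_def)
    next
      case False
      then have nz: "b \<ominus> b' \<noteq> \<zero>" using C by (simp add: minus_eq_zero_iff)
      \<comment> \<open>For fixed \<open>x\<close> the argument \<open>x + v (b - b')\<close> runs
        through the whole field with \<open>v\<close>, so the sum over \<open>v\<close> is taken
        first.\<close>
      have "(\<Sum>v\<in>?K. \<Sum>x\<in>?K. dev ms x * dev ms (x \<oplus> v \<otimes> (b \<ominus> b')))
          = (\<Sum>x\<in>?K. dev ms x * (\<Sum>v\<in>?K. dev ms (x \<oplus> v \<otimes> (b \<ominus> b'))))"
        by (subst sum.swap) (simp add: sum_distrib_left)
      also have "\<dots> = (\<Sum>x\<in>?K. dev ms x * (\<Sum>v\<in>?K. dev ms v))"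
        using C nz by (intro sum.cong refl) (subst sum_affine, auto)
      finally show ?thesis using False sum_dev[OF assms] by simp
    qed
    finally show ?thesis .
  qed
  have "(\<Sum>v\<in>?K. nrm (v # ms)) = (\<Sum>b\<in>A. \<Sum>b'\<in>A. I b b')"
    unfolding nrm_def I_def dev.simps power2_eq_square sum_product sum_swap_pair[of _ A A "carrier R"]
    by (rule refl)
  also have "\<dots> = (\<Sum>b\<in>A. \<Sum>b'\<in>A. if b = b' then q * nrm ms else 0)"
    by (intro sum.cong refl I)
  also have "\<dots> = q * a * nrm ms" by (simp add: a_def)
  finally show ?thesis .
qed

lemma nrm_Nil_le: "nrm [] \<le> 1"
proof -
  have "nrm [] = (\<Sum>x\<in>carrier R. (if x = \<zero> then 1 - 2 / q else 0) + 1 / q\<^sup>2)"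
    unfolding nrm_def dev.simps by (intro sum.cong) (auto simp: power2_eq_square algebra_simps)
  also have "\<dots> = 1 - 2 / q + q / q\<^sup>2"
    by (simp add: sum.distrib q_def)
  also have "\<dots> = 1 - 1 / q"
    using q_ge_2 by (simp add: power2_eq_square field_simps)
  finally show ?thesis using q_ge_2 by simp
qed

lemma sum_nrm: "(\<Sum>m\<in>vecs n. nrm m) \<le> (q * a) ^ n"
proof (induction n)
  case 0
  then show ?case using nrm_Nil_le by simp
next
  case (Suc n)
  have "(\<Sum>m\<in>vecs (Suc n). nrm m) = (\<Sum>m\<in>vecs n. \<Sum>v\<in>carrier R. nrm (v # m))"
    by (simp add: sum_vecs_Suc sum.swap[of _ "vecs n"])
  also have "\<dots> = (\<Sum>m\<in>vecs n. q * a * nrm m)"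
    by (intro sum.cong refl sum_nrm_Cons) (auto simp: vecs_def)
  also have "\<dots> = q * a * (\<Sum>m\<in>vecs n. nrm m)" by (simp add: sum_distrib_left)
  also have "\<dots> \<le> q * a * (q * a) ^ n" using q_ge_2 by (intro mult_left_mono Suc) auto
  finally show ?case by simp
qed

text \<open>For the counts, this is the convolution of the distributions of two independent linear
  forms. It survives the subtraction of the means because deviations sum to zero; in particular
  \<open>dev []\<close>, a point mass minus a constant, acts as the identity on them.\<close>

lemma dev_append:
  "set xs \<subseteq> carrier R \<Longrightarrow> set ys \<subseteq> carrier R \<Longrightarrow> x \<in> carrier R \<Longrightarrow>
    dev (xs @ ys) x = (\<Sum>z\<in>carrier R. dev xs z * dev ys (x \<ominus> z))"
proof (induction xs arbitrary: x)
  case Nil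
  have "(\<Sum>z\<in>carrier R. dev [] z * dev ys (x \<ominus> z))
     = (\<Sum>z\<in>carrier R. if z = \<zero> then dev ys x else 0) - 1 / q * (\<Sum>z\<in>carrier R. dev ys (x \<ominus> z))"
    unfolding sum_distrib_left sum_subtractf[symmetric]
    using Nil by (intro sum.cong) (auto simp: algebra_simps a_minus_def)
  then show ?case using sum_reflect[of x "dev ys"] sum_dev[of ys] Nil by simp
next
  case (Cons v xs)
  let ?K = "carrier R"
  have "(\<Sum>z\<in>?K. dev (v # xs) z * dev ys (x \<ominus> z))
      = (\<Sum>b\<in>A. \<Sum>z\<in>?K. dev xs (z \<ominus> v \<otimes> b) * dev ys (x \<ominus> z))"
    by (simp add: sum_distrib_right sum.swap[of _ A])
  also have "\<dots> = (\<Sum>b\<in>A. \<Sum>z\<in>?K. dev xs z * dev ys (x \<ominus> v \<otimes> b \<ominus> z))"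
  proof (rule sum.cong[OF refl])
    fix b assume "b \<in> A"
    then have b: "b \<in> ?K" by simp
    have "(\<Sum>z\<in>?K. dev xs (z \<ominus> v \<otimes> b) * dev ys (x \<ominus> z))
       = (\<Sum>z\<in>?K. dev xs (z \<ominus> v \<otimes> b) * dev ys (x \<ominus> v \<otimes> b \<ominus> (z \<ominus> v \<otimes> b)))"
    proof (rule sum.cong[OF refl])
      fix z assume "z \<in> ?K"
      then have "x \<ominus> v \<otimes> b \<ominus> (z \<ominus> v \<otimes> b) = x \<ominus> z" using b Cons.prems by (simp, algebra)
      then show "dev xs (z \<ominus> v \<otimes> b) * dev ys (x \<ominus> z) =
         dev xs (z \<ominus> v \<otimes> b) * dev ys (x \<ominus> v \<otimes> b \<ominus> (z \<ominus> v \<otimes> b))" by simp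
    qed
    also have "\<dots> = (\<Sum>z\<in>?K. dev xs z * dev ys (x \<ominus> v \<otimes> b \<ominus> z))"
      using b Cons.prems
      by (intro sum_translate[of _ "\<lambda>z. dev xs z * dev ys (x \<ominus> v \<otimes> b \<ominus> z)"]) auto
    finally show "(\<Sum>z\<in>?K. dev xs (z \<ominus> v \<otimes> b) * dev ys (x \<ominus> z))
        = (\<Sum>z\<in>?K. dev xs z * dev ys (x \<ominus> v \<otimes> b \<ominus> z))" .
  qed
  also have "\<dots> = (\<Sum>b\<in>A. dev (xs @ ys) (x \<ominus> v \<otimes> b))"
    using Cons by (intro sum.cong refl Cons.IH[symmetric]) auto
  finally show ?case by simp
qed

text \<open>Cauchy-Schwarz for the convolution, as a reflection preserves the norm. It bounds a
  single deviation by the norms of two blocks of coefficients, which can then be chosen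
  freely.\<close>

lemma dev_append_sq_le:
  assumes "set xs \<subseteq> carrier R" "set ys \<subseteq> carrier R" "x \<in> carrier R"
  shows "(dev (xs @ ys) x)\<^sup>2 \<le> nrm xs * nrm ys"
proof -
  have "nrm ys = (\<Sum>z\<in>carrier R. (dev ys (x \<ominus> z))\<^sup>2)"
    unfolding nrm_def using sum_reflect[of x "\<lambda>z. (dev ys z)\<^sup>2"] assms by simp
  then show ?thesis
    unfolding dev_append[OF assms] using Cauchy_Schwarz_sum by (simp add: nrm_def)
qed

text \<open>Since \<open>u\<close> is invertible, the products \<open>u b\<close> are distinct, and
  the norm is exactly \<open>a - a\<^sup>2 / q\<close>. This saves a factor \<open>a\<close> over
  \<open>nrm_Cons_le\<close> and is the reason for restricting to nonzero entries later.\<close>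

lemma nrm_singleton_le:
  assumes "u \<in> carrier R" "u \<noteq> \<zero>"
  shows "nrm [u] \<le> a"
proof -
  let ?K = "carrier R"
  have u: "u \<in> Units R" using assms by (simp add: field_Units)
  have *: "(\<Sum>x\<in>?K. dev [] (x \<ominus> u \<otimes> b) * dev [] (x \<ominus> u \<otimes> b')) = of_bool (b = b') - 1 / q"
    if "b \<in> A" "b' \<in> A" for b b'
  proof -
    have C: "b \<in> ?K" "b' \<in> ?K" using that by auto
    have eq: "x \<ominus> u \<otimes> c = \<zero> \<longleftrightarrow> x = u \<otimes> c" if "x \<in> ?K" "c \<in> ?K" for x c
      using that assms by (simp add: minus_eq_zero_iff)
    have "(\<Sum>x\<in>?K. dev [] (x \<ominus> u \<otimes> b) * dev [] (x \<ominus> u \<otimes> b'))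
       = (\<Sum>x\<in>?K. (if x = u \<otimes> b then of_bool (u \<otimes> b = u \<otimes> b') else 0)
          - (if x = u \<otimes> b then 1 / q else 0) - (if x = u \<otimes> b' then 1 / q else 0) + (1/q)\<^sup>2)"
      using C by (intro sum.cong) (auto simp: eq power2_eq_square algebra_simps of_bool_def)
    also have "\<dots> = of_bool (u \<otimes> b = u \<otimes> b') - 1 / q - 1 / q + q * (1/q)\<^sup>2"
      using C assms by (simp add: sum.distrib sum_subtractf q_def)
    also have "\<dots> = of_bool (u \<otimes> b = u \<otimes> b') - 1 / q"
      using q_ge_2 by (simp add: power2_eq_square field_simps)
    also have "u \<otimes> b = u \<otimes> b' \<longleftrightarrow> b = b'" using C u Units_l_cancel by blast
    finally show ?thesis .
  qed
  have "nrm [u] = (\<Sum>b\<in>A. \<Sum>b'\<in>A. \<Sum>x\<in>?K. dev [] (x \<ominus> u \<otimes> b) * dev [] (x \<ominus> u \<otimes> b'))"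
    unfolding nrm_def dev.simps(2) power2_eq_square sum_product
    by (rule sum_swap_pair)
  also have "\<dots> = (\<Sum>b\<in>A. \<Sum>b'\<in>A. (if b = b' then 1 else 0) - 1 / q)"
    by (intro sum.cong refl) (simp only: *, simp add: of_bool_def)
  also have "\<dots> = a - a\<^sup>2 / q"
    by (simp add: sum_subtractf a_def power2_eq_square right_diff_distrib)
  finally show ?thesis using q_ge_2 by simp
qed

text \<open>Multiplying both sides of the linear equation by \<open>c\<close> keeps its
  solutions.\<close>

lemma dev_scale:
  "c \<in> carrier R \<Longrightarrow> c \<noteq> \<zero> \<Longrightarrow> set ms \<subseteq> carrier R \<Longrightarrow> x \<in> carrier R \<Longrightarrow>
    dev (map (\<lambda>m. c \<otimes> m) ms) (c \<otimes> x) = dev ms x"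
proof (induction ms arbitrary: x)
  case Nil
  then show ?case by (simp add: integral_iff)
next
  case (Cons v ms)
  have "c \<otimes> x \<ominus> c \<otimes> v \<otimes> b = c \<otimes> (x \<ominus> v \<otimes> b)" if "b \<in> carrier R" for b
    using that Cons.prems by (simp, algebra)
  then show ?case using Cons by (simp cong: sum.cong)
qed

subsection \<open>Moments\<close>

lemma sum_vecs_scale:
  fixes g :: "'a list \<Rightarrow> real"
  assumes "c \<in> carrier R" "c \<noteq> \<zero>"
  shows "(\<Sum>m\<in>vecs n. g (map (\<lambda>x. c \<otimes> x) m)) = (\<Sum>m\<in>vecs n. g m)"
proof -
  have c: "c \<in> Units R" using assms by (simp add: field_Units)
  have [simp]: "inv c \<otimes> (c \<otimes> x) = x" "c \<otimes> (inv c \<otimes> x) = x" if "x \<in> carrier R" for x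
    using that c assms by (simp_all add: m_assoc[symmetric] Units_l_inv Units_r_inv)
  show ?thesis using assms c
    by (intro sum.reindex_bij_witness[where i = "map (\<lambda>x. inv c \<otimes> x)" and j = "map (\<lambda>x. c \<otimes> x)"])
       (auto simp: vecs_def o_def subset_iff intro!: map_idI)
qed

text \<open>By scaling, all nonzero values have the same second moment, so each takes at most a
  share \<open>1 / (q - 1)\<close> of the sum of the norms. The factor 2 comes from
  \<open>q / 2 \<le> q - 1\<close>.\<close>

lemma second_moment_nonzero:
  assumes "t \<in> carrier R" "t \<noteq> \<zero>"
  shows "(\<Sum>m\<in>vecs n. (dev m t)\<^sup>2) \<le> 2 * q ^ n * a ^ n / q"
proof -
  let ?S = "\<lambda>t. \<Sum>m\<in>vecs n. (dev m t)\<^sup>2"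
  have t: "t \<in> Units R" using assms by (simp add: field_Units)
  have *: "?S s = ?S t" if "s \<in> carrier R - {\<zero>}" for s
  proof -
    define c where "c = s \<otimes> inv t"
    have ct: "c \<otimes> t = s" using that assms t by (simp add: c_def m_assoc Units_l_inv)
    then have c: "c \<in> carrier R" "c \<noteq> \<zero>" using that t assms by (auto simp: c_def)
    have "?S s = (\<Sum>m\<in>vecs n. (dev (map (\<lambda>x. c \<otimes> x) m) s)\<^sup>2)"
      by (rule sum_vecs_scale[OF c, symmetric])
    also have "\<dots> = ?S t"
      using c assms ct by (intro sum.cong refl) (metis (no_types, lifting) dev_scale mem_Collect_eq vecs_def)
    finally show ?thesis .
  qed
  have "(q - 1) * ?S t = (\<Sum>s\<in>carrier R - {\<zero>}. ?S s)"
    by (simp add: * q_def card_Diff_singleton of_nat_diff Suc_leI card_gt_0_iff)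
      (metis One_nat_def Suc_leI card_gt_0_iff empty_iff finite_carrier of_nat_1 of_nat_diff zero_closed)
  also have "\<dots> \<le> (\<Sum>s\<in>carrier R. ?S s)"
    by (intro sum_mono2) (auto intro: sum_nonneg)
  also have "\<dots> = (\<Sum>m\<in>vecs n. nrm m)"
    by (simp add: nrm_def sum.swap[of _ "vecs n"])
  also have "\<dots> \<le> (q * a) ^ n" by (rule sum_nrm)
  finally have le: "(q - 1) * ?S t \<le> (q * a) ^ n" .
  have "q / 2 * ?S t \<le> (q - 1) * ?S t"
    using q_ge_2 by (intro mult_right_mono sum_nonneg) auto
  then show ?thesis using le q_ge_2 by (simp add: field_simps power_mult_distrib)
qed

text \<open>Unlike at a nonzero point, \<open>dev m 0\<close> is not spread out by scaling; but for a fixed nonzero \<open>b\<close> in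
  \<open>A\<close> the average over \<open>v\<close> does spread \<open>dev ms (\<zero> \<ominus> v \<otimes> b)\<close>, so only \<open>b = 0\<close> is exceptional.\<close>

lemma sum_dev_Cons_zero_le:
  assumes "set ms \<subseteq> carrier R"
  shows "(\<Sum>v\<in>carrier R. (dev (v # ms) \<zero>)\<^sup>2) \<le> 2 * q * (dev ms \<zero>)\<^sup>2 + 2 * a\<^sup>2 * nrm ms"
proof -
  let ?K = "carrier R"
  define B where "B = A - {\<zero>}"
  define S where "S v = (\<Sum>b\<in>B. dev ms (\<zero> \<ominus> v \<otimes> b))" for v
  have B: "finite B" "real (card B) \<le> a" unfolding B_def a_def by (auto intro!: card_mono)
  have "(dev (v # ms) \<zero>)\<^sup>2 \<le> 2 * (dev ms \<zero>)\<^sup>2 + 2 * (S v)\<^sup>2" if "v \<in> ?K" for v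
  proof -
    \<comment> \<open>The term for \<open>b = \<zero>\<close> does not depend on \<open>v\<close>;
      after summation over \<open>v\<close> it carries the factor \<open>q\<close>.\<close>
    have split: "dev (v # ms) \<zero> = (if \<zero> \<in> A then dev ms \<zero> else 0) + S v"
    proof (cases "\<zero> \<in> A")
      case True
      have "dev (v # ms) \<zero> = dev ms (\<zero> \<ominus> v \<otimes> \<zero>) + S v"
        unfolding dev.simps S_def B_def using True by (intro sum.remove) auto
      then show ?thesis using True that by (simp add: a_minus_def)
    qed (simp add: S_def B_def)
    have gen: "(x + y)\<^sup>2 \<le> 2 * x\<^sup>2 + 2 * y\<^sup>2" for x y :: real
      using zero_le_power2[of "x - y"] by (simp add: power2_sum power2_diff)
    show ?thesis
      unfolding split by (rule order_trans[OF gen]) auto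
  qed
  then have "(\<Sum>v\<in>?K. (dev (v # ms) \<zero>)\<^sup>2) \<le> (\<Sum>v\<in>?K. 2 * (dev ms \<zero>)\<^sup>2 + 2 * (S v)\<^sup>2)"
    by (rule sum_mono)
  also have "\<dots> = 2 * q * (dev ms \<zero>)\<^sup>2 + 2 * (\<Sum>v\<in>?K. (S v)\<^sup>2)"
    by (simp add: sum.distrib sum_distrib_left q_def)
  also have "(\<Sum>v\<in>?K. (S v)\<^sup>2) \<le> (\<Sum>v\<in>?K. real (card B) * (\<Sum>b\<in>B. (dev ms (\<zero> \<ominus> v \<otimes> b))\<^sup>2))"
    unfolding S_def by (intro sum_mono Cauchy_Schwarz_card)
  also have "\<dots> = real (card B) * (\<Sum>b\<in>B. \<Sum>v\<in>?K. (dev ms (\<zero> \<ominus> v \<otimes> b))\<^sup>2)"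
    by (simp add: sum_distrib_left[symmetric] sum.swap[of _ B])
  also have "\<dots> = real (card B) * (\<Sum>b\<in>B. nrm ms)"
  proof (intro arg_cong2[of _ _ _ _ "(*)"] sum.cong refl)
    fix b assume "b \<in> B"
    then have b: "b \<in> ?K" "b \<noteq> \<zero>" by (auto simp: B_def)
    have "(\<Sum>v\<in>?K. (dev ms (\<zero> \<ominus> v \<otimes> b))\<^sup>2) = (\<Sum>v\<in>?K. (dev ms (\<zero> \<oplus> v \<otimes> (\<ominus> b)))\<^sup>2)"
      using b by (intro sum.cong refl) (simp add: a_minus_def r_minus)
    also have "\<dots> = nrm ms"
      unfolding nrm_def using b by (intro sum_affine[of \<zero> "\<ominus> b" "\<lambda>x. (dev ms x)\<^sup>2"]) auto
    finally show "(\<Sum>v\<in>?K. (dev ms (\<zero> \<ominus> v \<otimes> b))\<^sup>2) = nrm ms" .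
  qed
  also have "\<dots> \<le> a * (a * nrm ms)"
    using B by (simp, intro mult_mono mult_right_mono) auto
  finally show ?thesis by (simp add: power2_eq_square mult.assoc)
qed

lemma second_moment_zero_Suc:
  "(\<Sum>m\<in>vecs (Suc n). (dev m \<zero>)\<^sup>2)
     \<le> 2 * q * (\<Sum>m\<in>vecs n. (dev m \<zero>)\<^sup>2) + 2 * a\<^sup>2 * (q * a) ^ n"
proof -
  have "(\<Sum>m\<in>vecs (Suc n). (dev m \<zero>)\<^sup>2) = (\<Sum>m\<in>vecs n. \<Sum>v\<in>carrier R. (dev (v # m) \<zero>)\<^sup>2)"
    unfolding sum_vecs_Suc by (rule sum.swap)
  also have "\<dots> \<le> (\<Sum>m\<in>vecs n. 2 * q * (dev m \<zero>)\<^sup>2 + 2 * a\<^sup>2 * nrm m)"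
    by (intro sum_mono sum_dev_Cons_zero_le) (auto simp: vecs_def)
  also have "\<dots> = 2 * q * (\<Sum>m\<in>vecs n. (dev m \<zero>)\<^sup>2) + 2 * a\<^sup>2 * (\<Sum>m\<in>vecs n. nrm m)"
    by (simp add: sum.distrib sum_distrib_left)
  also have "\<dots> \<le> 2 * q * (\<Sum>m\<in>vecs n. (dev m \<zero>)\<^sup>2) + 2 * a\<^sup>2 * (q * a) ^ n"
    by (intro add_left_mono mult_left_mono sum_nrm) auto
  finally show ?thesis .
qed

text \<open>Three rounds of the recurrence, starting from \<open>T 0 \<le> 1\<close>. The term
  \<open>2 * q\<^sup>2 * a ^ 4\<close> added in the last round dominates; the inherited ones have
  lower degree in \<open>a\<close>, and 22 = 16 + 4 + 2.\<close>

lemma second_moment_zero_3: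
  assumes "q \<le> a\<^sup>2"
  shows "(\<Sum>m\<in>vecs 3. (dev m \<zero>)\<^sup>2) \<le> 22 * a ^ 4 * q\<^sup>2"
proof -
  define T where "T n = (\<Sum>m\<in>vecs n. (dev m \<zero>)\<^sup>2)" for n
  have T: "T (Suc n) \<le> 2 * q * T n + 2 * a\<^sup>2 * (q * a) ^ n" for n
    unfolding T_def by (rule second_moment_zero_Suc)
  have a1: "1 \<le> a\<^sup>2" using assms q_ge_2 by linarith
  have "T 0 \<le> nrm []" unfolding T_def by (simp add: dev_sq_le_nrm del: dev.simps)
  then have "T 0 \<le> 1" using nrm_Nil_le by simp
  then have "2 * q * T 0 \<le> 2 * q" using q_ge_2 by simp
  then have T1: "T 1 \<le> 2 * q + 2 * a\<^sup>2" using T[of 0] by simp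
  then have T1': "T 1 \<le> 4 * a\<^sup>2" using assms by linarith
  have "2 * q * T 1 \<le> 2 * q * (4 * a\<^sup>2)" using q_ge_2 by (intro mult_left_mono T1') auto
  then have T2: "T 2 \<le> 8 * q * a\<^sup>2 + 2 * a\<^sup>2 * (q * a)" using T[of 1] by (simp add: numeral_2_eq_2 mult_ac)
  have "2 * q * T 2 \<le> 2 * q * (8 * q * a\<^sup>2 + 2 * a\<^sup>2 * (q * a))" using q_ge_2 by (intro mult_left_mono T2) auto
  then have T3: "T 3 \<le> 16 * q\<^sup>2 * a\<^sup>2 + 4 * q\<^sup>2 * a ^ 3 + 2 * q\<^sup>2 * a ^ 4"
    using T[of 2] by (simp add: numeral_3_eq_3 numeral_2_eq_2 power_mult_distrib algebra_simps power2_eq_square eval_nat_numeral)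
  have a1': "1 \<le> a" using a1 a_nonneg by (simp add: abs_le_square_iff[of 1 a, simplified])
  have "q\<^sup>2 * a\<^sup>2 \<le> q\<^sup>2 * a ^ 4" "q\<^sup>2 * a ^ 3 \<le> q\<^sup>2 * a ^ 4"
    using a1' by (intro mult_left_mono power_increasing; simp)+
  then show ?thesis using T3 unfolding T_def[of 3] by (simp add: algebra_simps)
qed

section \<open>Deviations as counts of solutions\<close>

definition solcount :: "nat \<Rightarrow> (nat \<Rightarrow> 'a) \<Rightarrow> 'a \<Rightarrow> nat" where
  "solcount n c x = card {y \<in> {..<n} \<rightarrow>\<^sub>E A. (\<Oplus>j\<in>{..<n}. c j \<otimes> y j) = x}"

lemma finite_PiE_A [simp]: "finite I \<Longrightarrow> finite (I \<rightarrow>\<^sub>E A)"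
  by (simp add: finite_PiE)

lemma solcount_Suc:
  assumes "c \<in> {..<Suc n} \<rightarrow> carrier R" "x \<in> carrier R"
  shows "solcount (Suc n) c x = (\<Sum>b\<in>A. solcount n c (x \<ominus> c n \<otimes> b))"
proof -
  let ?S = "\<lambda>n x. {y \<in> {..<n} \<rightarrow>\<^sub>E A. (\<Oplus>j\<in>{..<n}. c j \<otimes> y j) = x}"
  have lin: "(\<Oplus>j\<in>{..<Suc n}. c j \<otimes> y j) = x \<longleftrightarrow>
      (\<Oplus>j\<in>{..<n}. c j \<otimes> restrict y {..<n} j) = x \<ominus> c n \<otimes> y n" if "y \<in> {..<Suc n} \<rightarrow> A" for y
  proof -
    have C: "y j \<in> carrier R" "c j \<in> carrier R" if "j < Suc n" for j
      using \<open>y \<in> _\<close> assms that by (auto simp: Pi_iff)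
    define s where "s = (\<Oplus>j\<in>{..<n}. c j \<otimes> y j)"
    have s: "s \<in> carrier R" unfolding s_def using C by (intro finsum_closed) auto
    have "(\<Oplus>j\<in>{..<Suc n}. c j \<otimes> y j) = c n \<otimes> y n \<oplus> s"
      unfolding lessThan_Suc s_def using C by (intro finsum_insert) auto
    moreover have "(\<Oplus>j\<in>{..<n}. c j \<otimes> restrict y {..<n} j) = s"
      unfolding s_def using C by (intro finsum_cong') auto
    moreover have "c n \<otimes> y n \<oplus> s = x \<longleftrightarrow> s = x \<ominus> c n \<otimes> y n"
      using s C[of n] assms by (metis a_comm a_minus_def add.inv_solve_right lessI m_closed)
    ultimately show ?thesis by simp
  qed
  have "bij_betw (\<lambda>y. (y n, restrict y {..<n})) (?S (Suc n) x) (SIGMA b:A. ?S n (x \<ominus> c n \<otimes> b))"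
  proof (rule bij_betwI[where g = "\<lambda>(b, y). y(n := b)"])
    show "(\<lambda>y. (y n, restrict y {..<n})) \<in> ?S (Suc n) x \<rightarrow> (SIGMA b:A. ?S n (x \<ominus> c n \<otimes> b))"
    proof
      fix y assume y: "y \<in> ?S (Suc n) x"
      then have "y \<in> {..<Suc n} \<rightarrow> A" by (auto simp: PiE_def)
      from lin[OF this] y show "(y n, restrict y {..<n}) \<in> (SIGMA b:A. ?S n (x \<ominus> c n \<otimes> b))"
        by (auto simp: PiE_def)
    qed
    show "(\<lambda>(b, y). y(n := b)) \<in> (SIGMA b:A. ?S n (x \<ominus> c n \<otimes> b)) \<rightarrow> ?S (Suc n) x"
    proof clarify
      fix b y assume b: "b \<in> A" and y: "y \<in> {..<n} \<rightarrow>\<^sub>E A" 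
        and eq: "(\<Oplus>j\<in>{..<n}. c j \<otimes> y j) = x \<ominus> c n \<otimes> b"
      have mem: "y(n := b) \<in> {..<Suc n} \<rightarrow>\<^sub>E A" using b y
        by (auto simp: PiE_def Pi_iff extensional_def less_Suc_eq)
      then have "y(n := b) \<in> {..<Suc n} \<rightarrow> A" by (auto simp: PiE_def)
      moreover have "restrict (y(n := b)) {..<n} = y"
        using y by (auto simp: PiE_def extensional_def fun_eq_iff)
      ultimately show "y(n := b) \<in> {..<Suc n} \<rightarrow>\<^sub>E A \<and> (\<Oplus>j\<in>{..<Suc n}. c j \<otimes> (y(n := b)) j) = x"
        using lin[of "y(n := b)"] eq mem by simp
    qed
  qed (auto simp: PiE_def extensional_def fun_eq_iff less_Suc_eq)
  then have "solcount (Suc n) c x = card (SIGMA b:A. ?S n (x \<ominus> c n \<otimes> b))"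
    unfolding solcount_def by (rule bij_betw_same_card)
  then show ?thesis unfolding solcount_def by (subst (asm) card_SigmaI) auto
qed

lemma solcount_cong:
  "(\<And>j. j < n \<Longrightarrow> c j = c' j) \<Longrightarrow> c' \<in> {..<n} \<rightarrow> carrier R \<Longrightarrow> solcount n c x = solcount n c' x"
  unfolding solcount_def
  by (intro arg_cong[of _ _ card] Collect_cong conj_cong refl arg_cong2[of _ _ _ _ "(=)"] finsum_cong')
     (auto simp: Pi_iff PiE_def)

text \<open>\<open>dev\<close> consumes its list from the head, while \<open>solcount_Suc\<close>
  removes the last variable; hence the reversal.\<close>

lemma solcount_eq_dev:
  "set ms \<subseteq> carrier R \<Longrightarrow> x \<in> carrier R \<Longrightarrow>
    real (solcount (length ms) (\<lambda>j. rev ms ! j) x) = a ^ length ms / q + dev ms x"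
proof (induction ms arbitrary: x)
  case Nil
  have "solcount 0 (\<lambda>j. rev [] ! j) x = (if x = \<zero> then 1 else 0)"
    by (auto simp: solcount_def)
  then show ?case by simp
next
  case (Cons v ms)
  let ?n = "length ms" and ?c = "\<lambda>j. rev (v # ms) ! j"
  have c: "?c j \<in> carrier R" if "j < Suc ?n" for j
    using Cons.prems that nth_mem[of j "rev (v # ms)"] by auto
  have cn: "?c ?n = v" by (simp add: nth_append)
  have "real (solcount (Suc ?n) ?c x) = (\<Sum>b\<in>A. real (solcount ?n ?c (x \<ominus> v \<otimes> b)))"
    using c Cons.prems by (subst solcount_Suc) (auto simp: cn simp del: rev.simps)
  also have "\<dots> = (\<Sum>b\<in>A. real (solcount ?n (\<lambda>j. rev ms ! j) (x \<ominus> v \<otimes> b)))"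
    using Cons.prems nth_mem[of _ "rev ms"]
    by (intro sum.cong refl arg_cong[of _ _ real] solcount_cong) (auto simp: nth_append)
  also have "\<dots> = (\<Sum>b\<in>A. a ^ ?n / q + dev ms (x \<ominus> v \<otimes> b))"
    using Cons.prems by (intro sum.cong refl Cons.IH) auto
  also have "\<dots> = a ^ length (v # ms) / q + dev (v # ms) x"
    by (simp add: sum.distrib a_def)
  finally show ?case by simp
qed

section \<open>A high moment at zero by products along a path\<close>

definition nzvecs :: "nat \<Rightarrow> 'a list set" where
  "nzvecs n = {ms. set ms \<subseteq> carrier R - {\<zero>} \<and> length ms = n}"

lemma nzvecs_subset: "nzvecs n \<subseteq> vecs n" by (auto simp: nzvecs_def vecs_def)

lemma finite_nzvecs [simp]: "finite (nzvecs n)"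
  using nzvecs_subset finite_vecs finite_subset by blast

lemma sum_nzvecs_Suc:
  "(\<Sum>ms\<in>nzvecs (Suc n). g ms) = (\<Sum>ms\<in>nzvecs n. \<Sum>v\<in>carrier R - {\<zero>}. g (v # ms))"
  for g :: "'a list \<Rightarrow> real"
proof -
  have "(\<Sum>ms\<in>nzvecs n. \<Sum>v\<in>carrier R - {\<zero>}. g (v # ms))
      = (\<Sum>(ms,v)\<in>nzvecs n \<times> (carrier R - {\<zero>}). g (v # ms))"
    by (simp add: sum.cartesian_product)
  also have "\<dots> = (\<Sum>ms\<in>nzvecs (Suc n). g ms)"
    by (rule sum.reindex_bij_witness[where i = "\<lambda>ms. (tl ms, hd ms)" and j = "\<lambda>(ms,v). v # ms"])
       (auto simp: nzvecs_def length_Suc_conv)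
  finally show ?thesis by simp
qed

text \<open>For \<open>d \<ge> 4\<close>, \<open>(dev m 0)\<^sup>2\<close> is at most a power of \<open>a\<close> times \<open>nrm [m\<^sub>i, m\<^sub>i\<^sub>+\<^sub>1]\<close>, for each \<open>i\<close>
  with \<open>i + 2 < d\<close>, and also at most one times the product of two such norms, of the first and the last
  pair. Multiplying \<open>d - 2\<close> such bounds puts together all the pairs along the path \<open>m\<close>, and the sum of
  this product over \<open>m\<close> can be computed one entry at a time.\<close>

fun path_prod :: "'a list \<Rightarrow> real" where
  "path_prod (u # v # ms) = nrm [u, v] * path_prod (v # ms)"
| "path_prod _ = 1"

lemma path_prod_nonneg [simp]: "path_prod ms \<ge> 0"
  by (induction ms rule: path_prod.induct) auto

lemma path_prod_append: "path_prod (ms @ [w, z]) = path_prod (ms @ [w]) * nrm [w, z]"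
  by (induction ms rule: path_prod.induct) (auto simp: mult.assoc)

text \<open>Only the edge \<open>nrm [v, u]\<close> contains the head \<open>v\<close>. Its sum over
  \<open>v\<close> is at most \<open>q * a * nrm [u]\<close>, and \<open>nrm [u] \<le> a\<close> as
  \<open>u\<close> is nonzero. So every entry contributes \<open>q * a\<^sup>2\<close>, except the
  last, which contributes \<open>q\<close>.\<close>

lemma sum_path_prod: "(\<Sum>ms\<in>nzvecs (Suc n). path_prod ms) \<le> q * (q * a\<^sup>2) ^ n"
proof (induction n)
  case 0
  have "nzvecs 0 = {[]}" by (auto simp: nzvecs_def)
  then have "(\<Sum>ms\<in>nzvecs (Suc 0). path_prod ms) = real (card (carrier R - {\<zero>}))"
    by (simp add: sum_nzvecs_Suc)
  also have "\<dots> \<le> q" unfolding q_def by (intro of_nat_mono card_mono) auto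
  finally show ?case by simp
next
  case (Suc n)
  have "(\<Sum>ms\<in>nzvecs (Suc (Suc n)). path_prod ms)
      = (\<Sum>ms\<in>nzvecs (Suc n). \<Sum>v\<in>carrier R - {\<zero>}. path_prod (v # ms))"
    by (rule sum_nzvecs_Suc)
  also have "\<dots> \<le> (\<Sum>ms\<in>nzvecs (Suc n). q * a\<^sup>2 * path_prod ms)"
  proof (rule sum_mono)
    fix ms assume "ms \<in> nzvecs (Suc n)"
    then obtain u us where ms: "ms = u # us" and u: "u \<in> carrier R" "u \<noteq> \<zero>"
      by (cases ms) (auto simp: nzvecs_def)
    have "(\<Sum>v\<in>carrier R - {\<zero>}. nrm [v, u]) \<le> (\<Sum>v\<in>carrier R. nrm [v, u])"
      by (intro sum_mono2) auto
    also have "\<dots> = q * a * nrm [u]" using u by (intro sum_nrm_Cons) auto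
    also have "\<dots> \<le> q * a * a" using u q_ge_2 by (intro mult_left_mono nrm_singleton_le) auto
    finally show "(\<Sum>v\<in>carrier R - {\<zero>}. path_prod (v # ms)) \<le> q * a\<^sup>2 * path_prod ms"
      using mult_right_mono[OF _ path_prod_nonneg[of "u # us"]]
      by (simp add: ms sum_distrib_right[symmetric] power2_eq_square mult.assoc[symmetric])
  qed
  also have "\<dots> = q * a\<^sup>2 * (\<Sum>ms\<in>nzvecs (Suc n). path_prod ms)"
    by (simp add: sum_distrib_left)
  also have "\<dots> \<le> q * a\<^sup>2 * (q * (q * a\<^sup>2) ^ n)"
    using q_ge_2 by (intro mult_left_mono Suc) auto
  finally show ?case by (simp add: mult_ac)
qed

text \<open>The list is cut after \<open>v\<close>. The entries of \<open>pre\<close> and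
  \<open>post\<close> are given up at the price \<open>a\<^sup>2\<close> each, but \<open>z\<close>,
  left alone at the end and nonzero, costs only \<open>a\<close>: hence the odd exponent.\<close>

lemma dev_sq_le_edge:
  assumes "set (pre @ [u, v] @ post @ [z]) \<subseteq> carrier R - {\<zero>}" "length (pre @ [u, v] @ post @ [z]) = k + 3"
  shows "(dev (pre @ [u, v] @ post @ [z]) \<zero>)\<^sup>2 \<le> a ^ (2 * k + 1) * nrm [u, v]"
proof -
  have k: "k = length pre + length post" using assms(2) by simp
  have "(dev ((pre @ [u, v]) @ (post @ [z])) \<zero>)\<^sup>2 \<le> nrm (pre @ [u, v]) * nrm (post @ [z])"
    using assms(1) by (intro dev_append_sq_le) auto
  also have "\<dots> \<le> (a ^ (2 * length pre) * nrm [u, v]) * (a ^ (2 * length post) * nrm [z])"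
    using assms(1) by (intro mult_mono nrm_append_le) auto
  also have "\<dots> \<le> (a ^ (2 * length pre) * nrm [u, v]) * (a ^ (2 * length post) * a)"
    using assms(1) by (intro mult_left_mono nrm_singleton_le) auto
  also have "\<dots> = a ^ (2 * k + 1) * nrm [u, v]"
    by (simp add: k power_add distrib_left mult_ac)
  finally show ?thesis by simp
qed

text \<open>One factor is spent on each edge of \<open>xs\<close>, after which the head of
  \<open>xs\<close> moves to \<open>pre\<close>. The last edge is left out, because
  \<open>dev_sq_le_edge\<close> needs an entry behind the edge.\<close>

lemma dev_power_le_path_prod_butlast:
  assumes "set (pre @ xs) \<subseteq> carrier R - {\<zero>}" "length (pre @ xs) = k + 3" "length xs = l + 2"
  shows "((dev (pre @ xs) \<zero>)\<^sup>2) ^ l \<le> a ^ ((2 * k + 1) * l) * path_prod (butlast xs)"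
  using assms
proof (induction l arbitrary: pre xs)
  case (Suc l)
  obtain u v ys where "xs = u # v # ys" "ys \<noteq> []"
    using Suc.prems(3) by (cases xs; cases "tl xs"; cases "tl (tl xs)"; auto)
  then obtain post z where xs: "xs = [u, v] @ post @ [z]"
    by (cases ys rule: rev_cases) auto
  let ?m = "pre @ xs"
  have "((dev ?m \<zero>)\<^sup>2) ^ Suc l = (dev ?m \<zero>)\<^sup>2 * ((dev ((pre @ [u]) @ v # post @ [z]) \<zero>)\<^sup>2) ^ l"
    by (simp add: xs)
  also have "\<dots> \<le> (a ^ (2 * k + 1) * nrm [u, v]) * (a ^ ((2 * k + 1) * l) * path_prod (butlast (v # post @ [z])))"
    using Suc.prems unfolding xs
    by (intro mult_mono Suc.IH dev_sq_le_edge) auto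
  also have "\<dots> = a ^ ((2 * k + 1) * Suc l) * path_prod (butlast xs)"
    by (simp add: xs butlast_append power_add algebra_simps)
  finally show ?case .
qed (auto simp: length_Suc_conv)

text \<open>The path has \<open>k + 3\<close> edges, but there are only \<open>k + 2\<close>
  factors. One of them pays for both end edges, which are disjoint as there are at least four
  entries; the other \<open>k + 1\<close> pay for one inner edge each.\<close>

lemma dev_power_le_path_prod:
  assumes "m \<in> nzvecs (k + 4)"
  shows "((dev m \<zero>)\<^sup>2) ^ (k + 2) \<le> a ^ (2 * k + (2 * k + 3) * (k + 1)) * path_prod m"
proof -
  obtain u v ys where "m = u # v # ys" "length ys = k + 2"
    using assms by (auto simp: nzvecs_def length_Suc_conv eval_nat_numeral)
  moreover then obtain mid w z where "ys = mid @ [w, z]" "length mid = k"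
    by (cases ys rule: rev_cases; cases "butlast ys" rule: rev_cases; auto)
  ultimately have m: "m = [u, v] @ mid @ [w, z]" and mid: "length mid = k" by auto
  have C: "set m \<subseteq> carrier R - {\<zero>}" using assms by (simp add: nzvecs_def)
  have "(dev ([u, v] @ mid @ [w, z]) \<zero>)\<^sup>2 \<le> nrm [u, v] * nrm (mid @ [w, z])"
    using C m by (intro dev_append_sq_le) auto
  also have "\<dots> \<le> nrm [u, v] * (a ^ (2 * k) * nrm [w, z])"
    using C m mid by (intro mult_left_mono order_trans[OF nrm_append_le]) auto
  finally have 1: "(dev m \<zero>)\<^sup>2 \<le> nrm [u, v] * (a ^ (2 * k) * nrm [w, z])" by (simp add: m)
  \<comment> \<open>The total length is \<open>(k + 1) + 3\<close>, so the bound for inner edges is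
    used with \<open>k + 1\<close> in place of \<open>k\<close>.\<close>
  have 2: "((dev ([u] @ v # mid @ [w, z]) \<zero>)\<^sup>2) ^ (k + 1)
      \<le> a ^ ((2 * (k + 1) + 1) * (k + 1)) * path_prod (butlast (v # mid @ [w, z]))"
    using C mid unfolding m by (intro dev_power_le_path_prod_butlast) auto
  have "((dev m \<zero>)\<^sup>2) ^ (k + 2) = (dev m \<zero>)\<^sup>2 * ((dev ([u] @ v # mid @ [w, z]) \<zero>)\<^sup>2) ^ (k + 1)"
    by (simp add: m)
  also have "\<dots> \<le> (nrm [u, v] * (a ^ (2 * k) * nrm [w, z])) *
      (a ^ ((2 * (k + 1) + 1) * (k + 1)) * path_prod (butlast (v # mid @ [w, z])))"
    by (intro mult_mono 1 2) auto
  also have "\<dots> = a ^ (2 * k + (2 * k + 3) * (k + 1)) * path_prod m"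
    using path_prod_append[of "v # mid" w z] by (simp add: m butlast_append power_add algebra_simps eval_nat_numeral)
  finally show ?thesis .
qed

lemma high_moment_zero:
  "(\<Sum>m\<in>nzvecs (k + 4). ((dev m \<zero>)\<^sup>2) ^ (k + 2))
    \<le> a ^ (2 * k + (2 * k + 3) * (k + 1)) * (q * (q * a\<^sup>2) ^ (k + 3))"
proof -
  have "(\<Sum>m\<in>nzvecs (k + 4). ((dev m \<zero>)\<^sup>2) ^ (k + 2))
      \<le> (\<Sum>m\<in>nzvecs (k + 4). a ^ (2 * k + (2 * k + 3) * (k + 1)) * path_prod m)"
    by (intro sum_mono dev_power_le_path_prod)
  also have "\<dots> = a ^ (2 * k + (2 * k + 3) * (k + 1)) * (\<Sum>m\<in>nzvecs (Suc (k + 3)). path_prod m)"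
    by (simp add: sum_distrib_left eval_nat_numeral)
  also have "\<dots> \<le> a ^ (2 * k + (2 * k + 3) * (k + 1)) * (q * (q * a\<^sup>2) ^ (k + 3))"
    by (intro mult_left_mono sum_path_prod) auto
  finally show ?thesis .
qed

end

section \<open>Cofactors\<close>

lemma (in abelian_group) add_pow_one: "x \<in> carrier G \<Longrightarrow> [(1::int)] \<cdot> x = x"
  by (simp add: add.int_pow_1)

lemma (in abelian_group) add_pow_minus_one: "x \<in> carrier G \<Longrightarrow> [(-1::int)] \<cdot> x = \<ominus> x"
  using add.int_pow_neg[of x 1] by (simp add: add.int_pow_1)

context cring
begin

definition perms_fixing :: "nat \<Rightarrow> nat set \<Rightarrow> (nat \<Rightarrow> nat) \<Rightarrow> (nat \<Rightarrow> nat) set" where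
  "perms_fixing d K c = {p. p permutes {..<d} \<and> (\<forall>i\<in>K. p i = c i)}"

text \<open>\<open>p\<close> remains a permutation of all of \<open>{..<d}\<close> with its full
  sign, so that expansions need neither alternating signs nor a renumbering of the remaining rows
  and columns.\<close>

definition leib_term :: "nat \<Rightarrow> nat set \<Rightarrow> (nat \<times> nat \<Rightarrow> 'a) \<Rightarrow> (nat \<Rightarrow> nat) \<Rightarrow> 'a" where
  "leib_term d K M p = [sign p] \<cdot> (\<Otimes>i\<in>{..<d} - K. M (i, p i))"

text \<open>The cofactor, with sign, of the rows in \<open>K\<close> and the columns \<open>c i\<close>, \<open>i \<in> K\<close>: for \<open>K = {}\<close> it
  is the determinant, and for \<open>K = {i}\<close> an ordinary cofactor.\<close>

definition pcof :: "nat \<Rightarrow> nat set \<Rightarrow> (nat \<Rightarrow> nat) \<Rightarrow> (nat \<times> nat \<Rightarrow> 'a) \<Rightarrow> 'a" where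
  "pcof d K c M = (\<Oplus>p\<in>perms_fixing d K c. leib_term d K M p)"

lemma finite_perms_fixing [simp]: "finite (perms_fixing d K c)"
  unfolding perms_fixing_def by (rule finite_subset[OF _ finite_permutations[of "{..<d}"]]) auto

lemma perms_fixing_lt: "p \<in> perms_fixing d K c \<Longrightarrow> i < d \<Longrightarrow> p i < d"
  unfolding perms_fixing_def using permutes_in_image[of p "{..<d}" i] by auto

lemma leib_prod_closed:
  assumes "M \<in> ({..<d} - K) \<times> {..<d} \<rightarrow> carrier R" "p \<in> perms_fixing d K' c"
  shows "(\<Otimes>i\<in>{..<d} - K. M (i, p i)) \<in> carrier R"
  using assms perms_fixing_lt[OF assms(2)] by (intro finprod_closed) (auto simp: Pi_iff)

lemma leib_term_closed:
  assumes "M \<in> ({..<d} - K) \<times> {..<d} \<rightarrow> carrier R" "p \<in> perms_fixing d K' c"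
  shows "leib_term d K M p \<in> carrier R"
  unfolding leib_term_def by (intro add.int_pow_closed leib_prod_closed[OF assms])

lemma pcof_closed:
  "M \<in> ({..<d} - K) \<times> {..<d} \<rightarrow> carrier R \<Longrightarrow> pcof d K c M \<in> carrier R"
  unfolding pcof_def by (intro finsum_closed) (auto intro: leib_term_closed)

lemma pcof_cong:
  assumes "\<And>i j. i < d \<Longrightarrow> i \<notin> K \<Longrightarrow> j < d \<Longrightarrow> M (i, j) = M' (i, j)"
    and "M' \<in> ({..<d} - K) \<times> {..<d} \<rightarrow> carrier R"
    and "\<And>i. i \<in> K \<Longrightarrow> c i = c' i"
  shows "pcof d K c M = pcof d K c' M'"
proof -
  have "leib_term d K M p = leib_term d K M' p" if "p \<in> perms_fixing d K c'" for p
    unfolding leib_term_def using assms perms_fixing_lt[OF that]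
    by (intro arg_cong[of _ _ "\<lambda>x. [sign p] \<cdot> x"] finprod_cong') (auto simp: Pi_iff)
  moreover have "perms_fixing d K c = perms_fixing d K c'"
    using assms(3) by (auto simp: perms_fixing_def)
  ultimately show ?thesis
    unfolding pcof_def using assms(2) by (intro finsum_cong') (auto intro: leib_term_closed)
qed

text \<open>Laplace expansion: the permutations are sorted by their value \<open>j\<close> at
  \<open>r\<close>. If \<open>j\<close> is already a prescribed value on \<open>K\<close>, the class
  is empty and the summand is zero.\<close>

lemma pcof_expand:
  assumes M: "M \<in> ({..<d} - K) \<times> {..<d} \<rightarrow> carrier R" and r: "r < d" "r \<notin> K"
  shows "pcof d K c M = (\<Oplus>j\<in>{..<d}. M (r, j) \<otimes> pcof d (insert r K) (c(r := j)) M)"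
proof -
  let ?P = "\<lambda>j. perms_fixing d (insert r K) (c(r := j))"
  have sub: "p \<in> perms_fixing d K c \<and> p r = j" if p: "p \<in> ?P j" for p j
  proof -
    have "p i = (c(r := j)) i" if "i \<in> insert r K" for i
      using p that unfolding perms_fixing_def by blast
    then have "p r = j" "\<And>i. i \<in> K \<Longrightarrow> p i = c i" using r by (simp, metis fun_upd_other insertI2)
    then show ?thesis using p unfolding perms_fixing_def by blast
  qed
  have U: "perms_fixing d K c = (\<Union>j\<in>{..<d}. ?P j)"
  proof (intro equalityI subsetI)
    fix p assume p: "p \<in> perms_fixing d K c"
    then have "p \<in> ?P (p r)" using r by (auto simp: perms_fixing_def)
    then show "p \<in> (\<Union>j\<in>{..<d}. ?P j)" using perms_fixing_lt[OF p r(1)] by blast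
  qed (use sub in blast)
  have M': "M \<in> ({..<d} - insert r K) \<times> {..<d} \<rightarrow> carrier R" using M by auto
  have Mr: "M (r, j) \<in> carrier R" if "j < d" for j using M r that by auto
  have "pcof d K c M = (\<Oplus>j\<in>{..<d}. \<Oplus>p\<in>?P j. leib_term d K M p)"
    unfolding pcof_def U
  proof (rule add.finprod_UN_disjoint)
    show "pairwise (\<lambda>j j'. disjnt (?P j) (?P j')) {..<d}"
      unfolding pairwise_def disjnt_def using sub by blast
    show "leib_term d K M p \<in> carrier R" if "p \<in> ?P j" for j p
      using sub[OF that] by (intro leib_term_closed[OF M]) blast
  qed auto
  also have "\<dots> = (\<Oplus>j\<in>{..<d}. M (r, j) \<otimes> pcof d (insert r K) (c(r := j)) M)"
  proof (rule finsum_cong')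
    fix j assume j: "j \<in> {..<d}"
    have "leib_term d K M p = M (r, j) \<otimes> leib_term d (insert r K) M p" if p: "p \<in> ?P j" for p
    proof -
      have eq: "{..<d} - K = insert r ({..<d} - insert r K)" using r by auto
      have "(\<Otimes>i\<in>insert r ({..<d} - insert r K). M (i, p i))
          = M (r, p r) \<otimes> (\<Otimes>i\<in>{..<d} - insert r K. M (i, p i))"
        using j Mr perms_fixing_lt[OF p] M' r by (intro finprod_insert) (auto simp: Pi_iff)
      then have "(\<Otimes>i\<in>{..<d} - K. M (i, p i)) = M (r, j) \<otimes> (\<Otimes>i\<in>{..<d} - insert r K. M (i, p i))"
        unfolding eq using sub[OF p] by simp
      then show ?thesis
        unfolding leib_term_def using leib_prod_closed[OF M' p] Mr j by (simp add: add_pow_rdistr_int)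
    qed
    then have "(\<Oplus>p\<in>?P j. leib_term d K M p) = (\<Oplus>p\<in>?P j. M (r, j) \<otimes> leib_term d (insert r K) M p)"
      using Mr j by (intro finsum_cong') (auto intro!: m_closed leib_term_closed[OF M'])
    also have "\<dots> = M (r, j) \<otimes> pcof d (insert r K) (c(r := j)) M"
      unfolding pcof_def 
      using Mr j leib_term_closed[OF M'] by (subst finsum_rdistr) auto
    finally show "(\<Oplus>p\<in>?P j. leib_term d K M p) = M (r, j) \<otimes> pcof d (insert r K) (c(r := j)) M" .
  qed (use Mr pcof_closed[OF M'] in auto)
  finally show ?thesis .
qed

text \<open>Composition with the transposition of the equal rows pairs every even permutation with
  an odd one whose term is the negative. The terms cancel in pairs, so the argument does not depend
  on the characteristic.\<close>

lemma pcof_eq_rows: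
  assumes M: "M \<in> {..<d} \<times> {..<d} \<rightarrow> carrier R" and ij: "i < d" "r < d" "i \<noteq> r"
    and eq: "\<And>j. j < d \<Longrightarrow> M (r, j) = M (i, j)"
  shows "pcof d {} c M = \<zero>"
proof -
  let ?t = "transpose i r"
  let ?P = "{p. p permutes {..<d}}"
  define E where "E = {p \<in> ?P. sign p = 1}"
  have t: "?t permutes {..<d}" using ij by (intro permutes_swap_id) auto
  have tt: "p \<circ> ?t \<circ> ?t = p" for p :: "nat \<Rightarrow> nat" by (simp add: o_assoc[symmetric])
  have sgn: "sign (p \<circ> ?t) = - sign p" if "p \<in> ?P" for p
    using that t ij permutation_permutes by (subst sign_compose) (auto simp: sign_swap_id)
  have comp: "p \<circ> ?t \<in> ?P" if "p \<in> ?P" for p using that t permutes_compose by auto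
  have fin: "finite E" unfolding E_def by (simp add: finite_permutations)
  have M': "M \<in> ({..<d} - {}) \<times> {..<d} \<rightarrow> carrier R" using M by auto
  have closed: "leib_term d {} M p \<in> carrier R" if "p \<in> ?P" for p
    by (rule leib_term_closed[OF M', of _ "{}" c]) (use that in \<open>simp add: perms_fixing_def\<close>)
  have flip: "leib_term d {} M (p \<circ> ?t) = \<ominus> leib_term d {} M p" if p: "p \<in> E" for p
  proof -
    have pP: "p \<in> ?P" "sign p = 1" using p by (auto simp: E_def)
    have C: "M (k, p l) \<in> carrier R" if "k < d" "l < d" for k l
      using M that pP permutes_in_image[of p "{..<d}" l] by auto
    have "(\<Otimes>k\<in>{..<d}. M (k, p k)) = (\<Otimes>k\<in>?t ` {..<d}. M (k, p k))"
      by (simp only: permutes_image[OF t])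
    also have "\<dots> = (\<Otimes>k\<in>{..<d}. M (?t k, p (?t k)))"
      using C permutes_in_image[OF t] permutes_image[OF t]
      by (intro finprod_reindex) (auto intro: permutes_inj_on[OF t])
    also have "\<dots> = (\<Otimes>k\<in>{..<d}. M (k, (p \<circ> ?t) k))"
    proof (rule finprod_cong')
      fix k assume k: "k \<in> {..<d}"
      then have "(p \<circ> ?t) k < d" using comp[OF pP(1)] permutes_in_image[of "p \<circ> ?t" "{..<d}" k] by auto
      then show "M (?t k, p (?t k)) = M (k, (p \<circ> ?t) k)"
        using eq[of "(p \<circ> ?t) k"] by (auto simp: transpose_def)
    next
      show "(\<lambda>k. M (k, (p \<circ> ?t) k)) \<in> {..<d} \<rightarrow> carrier R"
        using C permutes_in_image[OF t] by auto
    qed simp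
    finally have prod: "(\<Otimes>k\<in>{..<d}. M (k, p k)) = (\<Otimes>k\<in>{..<d}. M (k, (p \<circ> ?t) k))" .
    have "(\<Otimes>k\<in>{..<d}. M (k, p k)) \<in> carrier R" using C by (intro finprod_closed) auto
    then show ?thesis
      unfolding leib_term_def using prod sgn[OF pP(1)] pP(2)
      by (simp add: add_pow_one add_pow_minus_one)
  qed
  have P: "?P = E \<union> (\<lambda>p. p \<circ> ?t) ` E"
  proof (intro equalityI subsetI)
    fix p assume p: "p \<in> ?P"
    show "p \<in> E \<union> (\<lambda>p. p \<circ> ?t) ` E"
    proof (cases p rule: sign_cases)
      case odd
      then have "p \<circ> ?t \<in> E" using sgn[OF p] comp[OF p] by (auto simp: E_def)
      then show ?thesis using tt[of p] by (metis UnI2 image_eqI)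
    qed (use p in \<open>auto simp: E_def\<close>)
  qed (use comp in \<open>auto simp: E_def\<close>)
  have inj: "inj_on (\<lambda>p. p \<circ> ?t) E" by (rule inj_on_inverseI[of _ "\<lambda>p. p \<circ> ?t"]) (rule tt)
  have disj: "E \<inter> (\<lambda>p. p \<circ> ?t) ` E = {}" using sgn by (fastforce simp: E_def)
  have CE: "leib_term d {} M \<in> E \<rightarrow> carrier R" "leib_term d {} M \<in> (\<lambda>p. p \<circ> ?t) ` E \<rightarrow> carrier R"
    using closed comp by (auto simp: E_def)
  have "pcof d {} c M = (\<Oplus>p\<in>E \<union> (\<lambda>p. p \<circ> ?t) ` E. leib_term d {} M p)"
    unfolding pcof_def P[symmetric] by (simp add: perms_fixing_def)
  also have "\<dots> = (\<Oplus>p\<in>E. leib_term d {} M p) \<oplus> (\<Oplus>p\<in>(\<lambda>p. p \<circ> ?t) ` E. leib_term d {} M p)"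
    using fin disj CE by (intro finsum_Un_disjoint) auto
  also have "(\<Oplus>p\<in>(\<lambda>p. p \<circ> ?t) ` E. leib_term d {} M p) = (\<Oplus>p\<in>E. leib_term d {} M (p \<circ> ?t))"
    by (rule finsum_reindex[OF CE(2) inj])
  also have "(\<Oplus>p\<in>E. leib_term d {} M p) \<oplus> \<dots> = (\<Oplus>p\<in>E. leib_term d {} M p \<oplus> leib_term d {} M (p \<circ> ?t))"
    using CE by (intro finsum_addf[symmetric]) auto
  also have "\<dots> = (\<Oplus>p\<in>E. \<zero>)"
    using CE(1) by (intro finsum_cong') (auto simp: flip r_neg Pi_iff)
  finally show ?thesis by (simp add: finsum_zero)
qed

text \<open>Overwriting row \<open>r\<close> by row \<open>i\<close> does not change the cofactors
  of row \<open>r\<close> and produces two equal rows; the sum is the expansion of that vanishing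
  determinant along row \<open>r\<close>.\<close>

lemma pcof_orthogonal:
  assumes M: "M \<in> ({..<d} - {r}) \<times> {..<d} \<rightarrow> carrier R" and ir: "i < d" "r < d" "i \<noteq> r"
  shows "(\<Oplus>j\<in>{..<d}. M (i, j) \<otimes> pcof d {r} (\<lambda>_. j) M) = \<zero>"
proof -
  define M' where "M' = (\<lambda>(k, j). M (if k = r then i else k, j))"
  have M': "M' \<in> ({..<d} - {}) \<times> {..<d} \<rightarrow> carrier R" using M ir by (auto simp: M'_def Pi_iff)
  have "\<zero> = pcof d {} (\<lambda>_. 0) M'"
    by (rule pcof_eq_rows[of _ _ i r, symmetric]) (use M' ir in \<open>auto simp: M'_def\<close>)
  also have "\<dots> = (\<Oplus>j\<in>{..<d}. M' (r, j) \<otimes> pcof d {r} ((\<lambda>_. 0)(r := j)) M')"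
    using ir by (intro pcof_expand[OF M']) auto
  also have "\<dots> = (\<Oplus>j\<in>{..<d}. M (i, j) \<otimes> pcof d {r} (\<lambda>_. j) M)"
  proof (rule finsum_cong')
    fix j
    have "pcof d {r} ((\<lambda>_. 0)(r := j)) M' = pcof d {r} (\<lambda>_. j) M"
      using M by (intro pcof_cong) (auto simp: M'_def)
    then show "M' (r, j) \<otimes> pcof d {r} ((\<lambda>_. 0)(r := j)) M' = M (i, j) \<otimes> pcof d {r} (\<lambda>_. j) M"
      by (simp add: M'_def)
  qed (use M ir pcof_closed[OF M] in auto)
  finally show ?thesis ..
qed

lemma pcof_repeated_column:
  assumes "r \<in> K" "s \<in> K" "r \<noteq> s" "c r = c s"
  shows "pcof d K c M = \<zero>"
proof -
  have "perms_fixing d K c = {}"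
  proof (rule ccontr)
    assume "perms_fixing d K c \<noteq> {}"
    then obtain p where p: "p permutes {..<d}" "p r = c r" "p s = c s"
      using assms(1,2) unfolding perms_fixing_def by blast
    then have "r = s" using permutes_inj[OF p(1)] assms(4) by (metis injD)
    then show False using assms(3) by simp
  qed
  then show ?thesis by (simp add: pcof_def)
qed

text \<open>The source of the savings in the counts below: a variable with invertible coefficient is
  a function of the others. Variables with coefficient zero need not agree, which allows two
  equations to be solved one after the other.\<close>

lemma linear_form_eq_imp_eq:
  assumes fin: "finite J" and j: "j \<in> J" "c j \<in> Units R"
    and c: "c \<in> J \<rightarrow> carrier R" and y: "y \<in> J \<rightarrow> carrier R" "y' \<in> J \<rightarrow> carrier R"
    and eq: "\<And>i. i \<in> J - {j} \<Longrightarrow> c i \<noteq> \<zero> \<Longrightarrow> y i = y' i"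
    and form: "(\<Oplus>i\<in>J. c i \<otimes> y i) = (\<Oplus>i\<in>J. c i \<otimes> y' i)"
  shows "y j = y' j"
proof -
  have J: "J = insert j (J - {j})" using j by auto
  have S: "(\<Oplus>i\<in>J. c i \<otimes> z i) = c j \<otimes> z j \<oplus> (\<Oplus>i\<in>J - {j}. c i \<otimes> z i)" if "z \<in> J \<rightarrow> carrier R" for z
    using fin that c j by (subst J, intro finsum_insert) auto
  have rest: "(\<Oplus>i\<in>J - {j}. c i \<otimes> y i) = (\<Oplus>i\<in>J - {j}. c i \<otimes> y' i)"
  proof (rule finsum_cong')
    fix i assume i: "i \<in> J - {j}"
    show "c i \<otimes> y i = c i \<otimes> y' i"
      using eq[OF i] i y c by (cases "c i = \<zero>") (auto simp: Pi_iff)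
  qed (use c y in auto)
  have "(\<Oplus>i\<in>J - {j}. c i \<otimes> y' i) \<in> carrier R" using c y by (intro finsum_closed) auto
  then have "c j \<otimes> y j = c j \<otimes> y' j"
    using form rest S[OF y(1)] S[OF y(2)] c y j by (auto simp: Pi_iff)
  then show ?thesis using j c y Units_l_cancel[of "c j" "y j" "y' j"] by auto
qed

end

section \<open>Counting functions by the coordinates that determine them\<close>

lemma card_le_fibres:
  assumes "finite B" "finite C" "f ` B \<subseteq> C" "\<And>y. y \<in> C \<Longrightarrow> card {x \<in> B. f x = y} \<le> k"
  shows "card B \<le> k * card C"
proof -
  have "card B = (\<Sum>y\<in>C. card {x \<in> B. f x = y})"
    using sum.group[OF assms(1-3), of "\<lambda>_. 1::nat"] by simp
  also have "\<dots> \<le> (\<Sum>y\<in>C. k)" by (intro sum_mono assms)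
  finally show ?thesis by (simp add: mult.commute)
qed

lemma card_PiE_determined:
  assumes I: "finite I" and A: "finite A" and sub: "B \<subseteq> I \<rightarrow>\<^sub>E A" "J \<subseteq> I"
    and det: "\<And>x y. x \<in> B \<Longrightarrow> y \<in> B \<Longrightarrow> (\<And>k. k \<in> J \<Longrightarrow> x k = y k) \<Longrightarrow> x = y"
  shows "card B \<le> card A ^ card J"
proof -
  have J: "finite J" using I sub finite_subset by blast
  have "inj_on (\<lambda>f. restrict f J) B"
    by (rule inj_onI) (metis det restrict_apply')
  moreover have "(\<lambda>f. restrict f J) ` B \<subseteq> J \<rightarrow>\<^sub>E A"
    using sub by (auto simp: PiE_def Pi_iff subset_iff)
  ultimately have "card B \<le> card (J \<rightarrow>\<^sub>E A)"
    using J A by (intro card_inj_on_le) (auto intro: finite_PiE)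
  then show ?thesis using J by (simp add: card_PiE)
qed

lemma card_PiE_rows:
  assumes fin: "finite S" "finite T" "finite A" and H: "H \<subseteq> T \<rightarrow>\<^sub>E A"
    and B: "B \<subseteq> (S \<times> T) \<rightarrow>\<^sub>E A" "\<And>M i. M \<in> B \<Longrightarrow> i \<in> S \<Longrightarrow> (\<lambda>j\<in>T. M (i, j)) \<in> H"
  shows "card B \<le> card H ^ card S"
proof -
  let ?g = "\<lambda>M. \<lambda>i\<in>S. \<lambda>j\<in>T. M (i, j)"
  have "inj_on ?g B"
  proof (rule inj_onI)
    fix M M' assume M: "M \<in> B" "M' \<in> B" and eq: "?g M = ?g M'"
    show "M = M'"
    proof (rule PiE_ext[of M "S \<times> T" "\<lambda>_. A" M'])
      fix x assume "x \<in> S \<times> T"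
      then obtain i j where x: "x = (i, j)" "i \<in> S" "j \<in> T" by auto
      have "?g M i j = ?g M' i j" using eq by simp
      then show "M x = M' x" using x by simp
    qed (use M B in auto)
  qed
  moreover have "?g ` B \<subseteq> S \<rightarrow>\<^sub>E H" using B by auto
  moreover have "finite H" using H fin finite_subset finite_PiE by metis
  ultimately have "card B \<le> card (S \<rightarrow>\<^sub>E H)"
    using fin by (intro card_inj_on_le) (auto intro: finite_PiE)
  then show ?thesis using fin by (simp add: card_PiE)
qed

lemma card_restrict_fibres:
  assumes fin: "finite I" "finite A" and I: "I = I' \<union> J" and B: "B \<subseteq> I \<rightarrow>\<^sub>E A"
    and D: "(\<lambda>M. restrict M I') ` B \<subseteq> D" "finite D"
  shows "card B \<le> card A ^ card J * card D"
proof (rule card_le_fibres[of _ _ "\<lambda>M. restrict M I'"])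
  show "finite B" using fin B finite_subset finite_PiE by metis
  fix y
  show "card {x \<in> B. restrict x I' = y} \<le> card A ^ card J"
  proof (rule card_PiE_determined[OF fin])
    show "{x \<in> B. restrict x I' = y} \<subseteq> I \<rightarrow>\<^sub>E A" "J \<subseteq> I" using B I by auto
    fix x x' assume x: "x \<in> {x \<in> B. restrict x I' = y}" "x' \<in> {x \<in> B. restrict x I' = y}"
      and J: "\<And>k. k \<in> J \<Longrightarrow> x k = x' k"
    show "x = x'"
    proof (rule PiE_ext[of x I "\<lambda>_. A" x'])
      fix i assume "i \<in> I"
      then consider "i \<in> J" | "i \<in> I'" using I by auto
      then show "x i = x' i"
      proof cases
        case 2
        have "restrict x I' i = restrict x' I' i" using x by simp
        then show ?thesis using 2 by simp
      qed (rule J)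
    qed (use x B in auto)
  qed
qed (use D in auto)

context finite_field_subset
begin

lemma Units_iff: "x \<in> Units R \<longleftrightarrow> x \<in> carrier R \<and> x \<noteq> \<zero>"
  by (simp add: field_Units)

lemma PiE_A_carrier: "M \<in> I \<rightarrow>\<^sub>E A \<Longrightarrow> J \<subseteq> I \<Longrightarrow> M \<in> J \<rightarrow> carrier R"
  by (auto simp: PiE_def Pi_iff)

text \<open>Expand along a row \<open>r\<close>: if some coefficient of the expansion is nonzero, then the
  corresponding entry of row \<open>r\<close> is determined by the others; otherwise use induction.\<close>

lemma pcof_zero_count:
  assumes "K \<subseteq> {..<d}" "inj_on c K" "c ` K \<subseteq> {..<d}" "card ({..<d} - K) = n"
  shows "card A * card {M \<in> (({..<d} - K) \<times> {..<d}) \<rightarrow>\<^sub>E A. pcof d K c M = \<zero>} \<le> n * card A ^ (n * d)"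
  using assms
proof (induction n arbitrary: K c)
  case 0
  then have K: "K = {..<d}" by auto
  have "pcof d K c M \<noteq> \<zero>" for M
  proof -
    \<comment> \<open>With all rows removed, \<open>c\<close> extended by the identity is the only
      permutation left, and the cofactor is its sign.\<close>
    define p where "p = (\<lambda>i. if i < d then c i else i)"
    have "bij_betw c {..<d} {..<d}"
      unfolding bij_betw_def using 0 K endo_inj_surj[of "{..<d}" c] by blast
    then have "p permutes {..<d}"
      using bij_betw_cong[of "{..<d}" p c "{..<d}"] by (intro bij_imp_permutes) (auto simp: p_def)
    then have "perms_fixing d K c = {p}"
      unfolding perms_fixing_def K
      by (auto simp: p_def fun_eq_iff permutes_def)
    then have "pcof d K c M = [sign p] \<cdot> \<one>"
      unfolding pcof_def leib_term_def K by simp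
    then show ?thesis
      by (cases p rule: sign_cases) (simp_all add: add_pow_one add_pow_minus_one)
  qed
  then show ?case by simp
next
  case (Suc n)
  let ?T = "{..<d}"
  have "{..<d} - K \<noteq> {}" using Suc.prems(4) by (metis card.empty nat.distinct(1))
  then obtain r where r: "r < d" "r \<notin> K" by auto
  have finK: "finite K" using Suc.prems(1) finite_subset by blast
  then have "card ({..<d} - K) = d - card K" using Suc.prems(1) by (simp add: card_Diff_subset)
  then have "card (c ` K) < card ?T" using Suc.prems(2,4) by (simp add: card_image)
  then have "\<not> ?T \<subseteq> c ` K" using finK card_mono[of "c ` K" ?T] by auto
  then obtain j where j: "j < d" "j \<notin> c ` K" by auto
  let ?K' = "insert r K" and ?c' = "c(r := j)"
  let ?I = "(?T - K) \<times> ?T" and ?I' = "(?T - ?K') \<times> ?T"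
  define Z where "Z = {M \<in> ?I \<rightarrow>\<^sub>E A. pcof d K c M = \<zero>}"
  define Z' where "Z' = {M \<in> ?I' \<rightarrow>\<^sub>E A. pcof d ?K' ?c' M = \<zero>}"
  define Z1 where "Z1 = {M \<in> Z. pcof d ?K' ?c' M \<noteq> \<zero>}"
  define Z2 where "Z2 = {M \<in> Z. pcof d ?K' ?c' M = \<zero>}"
  have finI: "finite ?I" "finite ?I'" by auto
  have cardI: "card ?I = Suc n * d" using Suc.prems(4) by (simp add: card_cartesian_product)
  have "{..<d} - ?K' = ({..<d} - K) - {r}" by auto
  then have "card ({..<d} - ?K') = n" using Suc.prems(4) r by simp
  moreover have "inj_on ?c' ?K'" using Suc.prems(2) r j by (auto simp: inj_on_def)
  moreover have "?c' ` ?K' \<subseteq> {..<d}" using Suc.prems(3) j by auto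
  moreover have "?K' \<subseteq> {..<d}" using Suc.prems(1) r by auto
  ultimately have IH: "card A * card Z' \<le> n * card A ^ (n * d)"
    unfolding Z'_def by (intro Suc.IH)
  have "Z = Z1 \<union> Z2" by (auto simp: Z1_def Z2_def)
  then have Z12: "card Z \<le> card Z1 + card Z2" by (simp add: card_Un_le)
  have Z1: "card Z1 \<le> card A ^ card (?I - {(r, j)})"
  proof (rule card_PiE_determined[OF finI(1) finite_A])
    show "Z1 \<subseteq> ?I \<rightarrow>\<^sub>E A" by (auto simp: Z1_def Z_def)
    show "?I - {(r, j)} \<subseteq> ?I" by auto
    fix M M' assume M: "M \<in> Z1" "M' \<in> Z1" and eq: "\<And>k. k \<in> ?I - {(r, j)} \<Longrightarrow> M k = M' k"
    have C: "M \<in> ?I \<rightarrow> carrier R" "M' \<in> ?I \<rightarrow> carrier R"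
      using M PiE_A_carrier[OF _ subset_refl] unfolding Z1_def Z_def by blast+
    have C': "M \<in> ?I' \<rightarrow> carrier R" "M' \<in> ?I' \<rightarrow> carrier R" using C by auto
    \<comment> \<open>The coefficients of the expansion do not involve row \<open>r\<close>, so they
      are common to \<open>M\<close> and \<open>M'\<close>.\<close>
    have same: "pcof d ?K' (c(r := l)) M = pcof d ?K' (c(r := l)) M'" for l
      using eq C' by (intro pcof_cong) auto
    have exp: "(\<Oplus>l\<in>?T. pcof d ?K' (c(r := l)) M \<otimes> N (r, l)) = \<zero>"
      if "N = M \<or> N = M'" for N
    proof -
      have N: "N \<in> Z1" "N \<in> ?I \<rightarrow> carrier R" using that M C by auto
      have "(\<Oplus>l\<in>?T. pcof d ?K' (c(r := l)) M \<otimes> N (r, l)) = (\<Oplus>l\<in>?T. N (r, l) \<otimes> pcof d ?K' (c(r := l)) N)"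
        using that same N(2) r C' pcof_closed
        by (intro finsum_cong') (auto simp: m_comm Pi_iff)
      also have "\<dots> = \<zero>" using pcof_expand[OF N(2) r, of c] N(1) by (simp add: Z1_def Z_def)
      finally show ?thesis .
    qed
    have "M (r, j) = M' (r, j)"
    proof (rule linear_form_eq_imp_eq[of ?T j "\<lambda>l. pcof d ?K' (c(r := l)) M" "\<lambda>l. M (r, l)" "\<lambda>l. M' (r, l)"])
      show "pcof d ?K' (c(r := j)) M \<in> Units R"
        using M pcof_closed[OF C'(1)] by (simp add: Units_iff Z1_def)
      show "(\<Oplus>l\<in>?T. pcof d ?K' (c(r := l)) M \<otimes> M (r, l)) = (\<Oplus>l\<in>?T. pcof d ?K' (c(r := l)) M \<otimes> M' (r, l))"
        using exp by simp
    qed (use j r eq C pcof_closed[OF C'(1)] in auto)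
    then have "M k = M' k" if "k \<in> ?I" for k using eq that by (cases "k = (r, j)") auto
    then show "M = M'" using M by (intro PiE_ext[of M ?I "\<lambda>_. A" M']) (auto simp: Z1_def Z_def)
  qed
  have "card (?I - {(r, j)}) = Suc n * d - 1" using r j cardI by (simp add: card_Diff_singleton)
  then have Z1': "card A * card Z1 \<le> card A ^ (Suc n * d)"
    using mult_le_mono2[OF Z1, of "card A"] j by (cases d) auto
  \<comment> \<open>Here row \<open>r\<close> is unconstrained, and the smaller cofactor of the
    remaining rows vanishes.\<close>
  have "card Z2 \<le> card A ^ card ({r} \<times> ?T) * card Z'"
  proof (rule card_restrict_fibres[OF finI(1) finite_A])
    show "?I = ?I' \<union> {r} \<times> ?T" using r by auto
    show "Z2 \<subseteq> ?I \<rightarrow>\<^sub>E A" by (auto simp: Z2_def Z_def)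
    show "(\<lambda>M. restrict M ?I') ` Z2 \<subseteq> Z'"
    proof clarify
      fix M assume M: "M \<in> Z2"
      then have MI: "M \<in> ?I \<rightarrow>\<^sub>E A" by (simp add: Z2_def Z_def)
      have "pcof d ?K' ?c' (restrict M ?I') = pcof d ?K' ?c' M"
        using PiE_A_carrier[OF MI, of ?I'] by (intro pcof_cong) auto
      then show "restrict M ?I' \<in> Z'" using M MI by (auto simp: Z'_def Z2_def)
    qed
    show "finite Z'" unfolding Z'_def using finI by (simp add: finite_PiE)
  qed
  then have "card A * card Z2 \<le> card A ^ d * (card A * card Z')"
    using mult_le_mono2[of "card Z2" _ "card A"] by (simp add: card_cartesian_product ac_simps)
  also have "\<dots> \<le> card A ^ d * (n * card A ^ (n * d))" by (intro mult_le_mono2 IH)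
  finally have "card A * card Z2 \<le> n * card A ^ (Suc n * d)" by (simp add: power_add ac_simps)
  then show ?case
    using Z1' mult_le_mono2[OF Z12, of "card A"] unfolding Z_def by (simp add: distrib_left)
qed

section \<open>Counting matrices with a given vector of cofactors\<close>

definition mats :: "nat \<Rightarrow> (nat \<times> nat \<Rightarrow> 'a) set" where
  "mats d = (({..<d} - {0}) \<times> {..<d}) \<rightarrow>\<^sub>E A"

text \<open>The cofactors of the missing row \<open>0\<close>, listed backwards to match \<open>solcount_eq_dev\<close>.\<close>

definition cofs :: "nat \<Rightarrow> (nat \<times> nat \<Rightarrow> 'a) \<Rightarrow> 'a list" where
  "cofs d M = map (\<lambda>j. pcof d {0} (\<lambda>_. j) M) (rev [0..<d])"

definition orth :: "'a list \<Rightarrow> (nat \<Rightarrow> 'a) set" where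
  "orth m = {y \<in> {..<length m} \<rightarrow>\<^sub>E A. (\<Oplus>j\<in>{..<length m}. rev m ! j \<otimes> y j) = \<zero>}"

lemma finite_mats [simp]: "finite (mats d)" unfolding mats_def by (simp add: finite_PiE)

lemma card_mats: "card (mats d) = card A ^ ((d - 1) * d)"
proof -
  have "card (({..<d} - {0}) \<times> {..<d}) = (d - 1) * d"
    by (cases d) (simp_all add: card_cartesian_product card_Diff_singleton)
  then show ?thesis unfolding mats_def by (subst card_PiE) auto
qed

lemma mats_carrier: "M \<in> mats d \<Longrightarrow> M \<in> ({..<d} - {0}) \<times> {..<d} \<rightarrow> carrier R"
  unfolding mats_def by (rule PiE_A_carrier) auto

lemma length_cofs [simp]: "length (cofs d M) = d" by (simp add: cofs_def)

lemma rev_cofs_nth: "j < d \<Longrightarrow> rev (cofs d M) ! j = pcof d {0} (\<lambda>_. j) M"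
  by (simp add: cofs_def rev_map)

lemma cofs_vecs: "M \<in> mats d \<Longrightarrow> cofs d M \<in> vecs d"
  using pcof_closed[OF mats_carrier] by (auto simp: cofs_def vecs_def)

lemma rev_nth_carrier: "m \<in> vecs d \<Longrightarrow> j < d \<Longrightarrow> rev m ! j \<in> carrier R"
  using nth_mem[of j "rev m"] by (auto simp: vecs_def)

lemma rev_nth_nonzero: "m \<in> nzvecs d \<Longrightarrow> j < d \<Longrightarrow> rev m ! j \<in> carrier R \<and> rev m ! j \<noteq> \<zero>"
  using nth_mem[of j "rev m"] by (auto simp: nzvecs_def)

lemma finite_orth [simp]: "finite (orth m)"
  unfolding orth_def by (simp add: finite_PiE)

lemma card_orth:
  "m \<in> vecs d \<Longrightarrow> real (card (orth m)) = a ^ d / q + dev m \<zero>"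
  using solcount_eq_dev[of m \<zero>] by (auto simp: orth_def solcount_def vecs_def)

lemma orth_scale:
  assumes "m \<in> vecs d" "c \<in> carrier R" "c \<noteq> \<zero>"
  shows "orth (map (\<lambda>x. c \<otimes> x) m) = orth m"
proof -
  have len: "length m = d" using assms by (simp add: vecs_def)
  have "(\<Oplus>j\<in>{..<d}. rev (map (\<lambda>x. c \<otimes> x) m) ! j \<otimes> y j) = c \<otimes> (\<Oplus>j\<in>{..<d}. rev m ! j \<otimes> y j)"
    if y: "y \<in> {..<d} \<rightarrow> carrier R" for y
  proof -
    have C: "rev m ! j \<in> carrier R" "y j \<in> carrier R" if "j < d" for j
      using that y rev_nth_carrier[OF assms(1)] by auto
    have "(\<Oplus>j\<in>{..<d}. rev (map (\<lambda>x. c \<otimes> x) m) ! j \<otimes> y j) = (\<Oplus>j\<in>{..<d}. c \<otimes> (rev m ! j \<otimes> y j))"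
    proof (rule finsum_cong')
      fix j assume "j \<in> {..<d}"
      then show "rev (map (\<lambda>x. c \<otimes> x) m) ! j \<otimes> y j = c \<otimes> (rev m ! j \<otimes> y j)"
        using C[of j] assms len by (simp add: rev_map m_assoc)
    qed (use C assms in auto)
    also have "\<dots> = c \<otimes> (\<Oplus>j\<in>{..<d}. rev m ! j \<otimes> y j)"
      using C assms by (subst finsum_rdistr) auto
    finally show ?thesis .
  qed
  moreover have "(\<Oplus>j\<in>{..<d}. rev m ! j \<otimes> y j) \<in> carrier R" if "y \<in> {..<d} \<rightarrow> carrier R" for y
    using that rev_nth_carrier[OF assms(1)] by (intro finsum_closed) auto
  ultimately have "(\<Oplus>j\<in>{..<d}. rev (map (\<lambda>x. c \<otimes> x) m) ! j \<otimes> y j) = \<zero> \<longleftrightarrow> (\<Oplus>j\<in>{..<d}. rev m ! j \<otimes> y j) = \<zero>"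
    if "y \<in> {..<d} \<rightarrow>\<^sub>E A" for y
    using PiE_A_carrier[OF that subset_refl] assms by (simp add: integral_iff)
  then show ?thesis unfolding orth_def by (auto simp: len)
qed

text \<open>\<open>cofs d M\<close> is the generalised cross product of the rows of
  \<open>M\<close>, hence orthogonal to each of them.\<close>

lemma row_in_orth:
  assumes M: "M \<in> mats d" and i: "i \<in> {..<d} - {0}"
  shows "(\<lambda>j\<in>{..<d}. M (i, j)) \<in> orth (cofs d M)"
proof -
  note C = mats_carrier[OF M]
  have mem: "(\<lambda>j\<in>{..<d}. M (i, j)) \<in> {..<d} \<rightarrow>\<^sub>E A"
    using M i unfolding mats_def by auto
  have "(\<Oplus>j\<in>{..<d}. rev (cofs d M) ! j \<otimes> (\<lambda>j\<in>{..<d}. M (i, j)) j)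
      = (\<Oplus>j\<in>{..<d}. M (i, j) \<otimes> pcof d {0} (\<lambda>_. j) M)"
  proof (rule finsum_cong')
    fix j assume "j \<in> {..<d}"
    then show "rev (cofs d M) ! j \<otimes> (\<lambda>j\<in>{..<d}. M (i, j)) j = M (i, j) \<otimes> pcof d {0} (\<lambda>_. j) M"
      using C i pcof_closed[OF C, of "\<lambda>_. j"] by (simp add: rev_cofs_nth m_comm Pi_iff)
  qed (use C i pcof_closed[OF C] in auto)
  also have "\<dots> = \<zero>" using i by (intro pcof_orthogonal[OF C]) auto
  finally show ?thesis unfolding orth_def using mem by simp
qed

lemma solcount_le:
  assumes c: "c \<in> {..<n} \<rightarrow> carrier R" and j: "j < n" "c j \<noteq> \<zero>"
  shows "card A * solcount n c x \<le> card A ^ n"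
proof -
  have "solcount n c x \<le> card A ^ card ({..<n} - {j})"
    unfolding solcount_def
  proof (rule card_PiE_determined)
    show "{y \<in> {..<n} \<rightarrow>\<^sub>E A. (\<Oplus>j\<in>{..<n}. c j \<otimes> y j) = x} \<subseteq> {..<n} \<rightarrow>\<^sub>E A" by auto
    fix y y' assume y: "y \<in> {y \<in> {..<n} \<rightarrow>\<^sub>E A. (\<Oplus>j\<in>{..<n}. c j \<otimes> y j) = x}"
        "y' \<in> {y \<in> {..<n} \<rightarrow>\<^sub>E A. (\<Oplus>j\<in>{..<n}. c j \<otimes> y j) = x}"
      and eq: "\<And>k. k \<in> {..<n} - {j} \<Longrightarrow> y k = y' k"
    have "y j = y' j"
    proof (rule linear_form_eq_imp_eq[of "{..<n}" j c y y'])
      show "c j \<in> Units R" using c j by (simp add: Units_iff Pi_iff)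
      show "y \<in> {..<n} \<rightarrow> carrier R" "y' \<in> {..<n} \<rightarrow> carrier R"
        using y PiE_A_carrier[OF _ subset_refl] by blast+
      show "(\<Oplus>i\<in>{..<n}. c i \<otimes> y i) = (\<Oplus>i\<in>{..<n}. c i \<otimes> y' i)" using y by simp
    qed (use c j eq in auto)
    then have "y k = y' k" if "k \<in> {..<n}" for k using eq[of k] that by (cases "k = j") auto
    then show "y = y'" using y by (intro PiE_ext[of y "{..<n}" "\<lambda>_. A" y']) auto
  qed auto
  then have "card A * solcount n c x \<le> card A * card A ^ (n - 1)"
    using j by (intro mult_le_mono2) (simp add: card_Diff_singleton)
  then show ?thesis using j by (cases n) auto
qed

text \<open>The trivial bound, for the few matrices with a vanishing cofactor. Count and mean are
  both nonnegative, and \<open>a\<close> times either is at most \<open>a ^ d\<close>: for the mean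
  because \<open>a \<le> q\<close>, for the count because one variable is determined or, if all
  coefficients vanish, because \<open>t \<noteq> \<zero>\<close> is never attained.\<close>

lemma abs_dev_le:
  assumes m: "m \<in> vecs d" and t: "t \<in> carrier R" "t \<noteq> \<zero>"
  shows "a * \<bar>dev m t\<bar> \<le> a ^ d"
proof -
  have len: "length m = d" and C: "set m \<subseteq> carrier R" using m by (auto simp: vecs_def)
  define N where "N = solcount d (\<lambda>j. rev m ! j) t"
  have N: "real N = a ^ d / q + dev m t"
    using solcount_eq_dev[OF C t(1)] len by (simp add: N_def)
  have "card A * N \<le> card A ^ d"
  proof (cases "\<exists>j<d. rev m ! j \<noteq> \<zero>")
    case True
    then show ?thesis
      unfolding N_def using rev_nth_carrier[OF m] by (auto intro!: solcount_le)
  next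
    case False
    have "(\<Oplus>j\<in>{..<d}. rev m ! j \<otimes> y j) = \<zero>" if "y \<in> {..<d} \<rightarrow>\<^sub>E A" for y
    proof -
      have "(\<Oplus>j\<in>{..<d}. rev m ! j \<otimes> y j) = (\<Oplus>j\<in>{..<d}. \<zero>)"
        using False PiE_A_carrier[OF that subset_refl] by (intro finsum_cong') (auto simp: Pi_iff)
      then show ?thesis by (simp add: finsum_zero)
    qed
    then have "{y \<in> {..<d} \<rightarrow>\<^sub>E A. (\<Oplus>j\<in>{..<d}. rev m ! j \<otimes> y j) = t} = {}" using t by auto
    then have "N = 0" unfolding N_def solcount_def by simp
    then show ?thesis by simp
  qed
  then have "real (card A * N) \<le> real (card A ^ d)" by (rule of_nat_mono)
  then have 1: "a * real N \<le> a ^ d" by (simp add: a_def)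
  have "a * a ^ d \<le> q * a ^ d" by (intro mult_right_mono a_le_q) simp
  then have 2: "a * (a ^ d / q) \<le> a ^ d" using q_ge_2 by (simp add: field_simps)
  have "\<bar>dev m t\<bar> \<le> max (real N) (a ^ d / q)"
    using N q_ge_2 by (auto simp: abs_le_iff max_def)
  then have "a * \<bar>dev m t\<bar> \<le> a * max (real N) (a ^ d / q)" by (intro mult_left_mono) auto
  also have "\<dots> \<le> a ^ d" using 1 2 by (auto simp: max_def)
  finally show ?thesis .
qed

definition fibre :: "nat \<Rightarrow> 'a list \<Rightarrow> (nat \<times> nat \<Rightarrow> 'a) set" where
  "fibre d m = {M \<in> mats d. cofs d M = m}"

lemma finite_fibre [simp]: "finite (fibre d m)" by (simp add: fibre_def)

text \<open>All rows lie in \<open>orth m\<close>, and row \<open>1\<close> satisfies a second, independent linear equation given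
  by the expansion of the cofactor \<open>m\<^sub>0\<close> along that row.\<close>

lemma card_fibre_le:
  assumes m: "m \<in> nzvecs d" and d: "d \<ge> 2"
  shows "card (fibre d m) \<le> card A ^ (d - 2) * card (orth m) ^ (d - 2)"
proof -
  let ?T = "{..<d}"
  let ?S = "?T - {0, 1}"
  let ?I = "(?T - {0}) \<times> ?T" and ?I' = "?S \<times> ?T"
  define C where "C = (\<lambda>M. restrict M ?I') ` fibre d m"
  have len: "length m = d" and mv: "m \<in> vecs d" using m nzvecs_subset by (auto simp: nzvecs_def)
  have "card ?S = d - 2" using d by (simp add: card_Diff_subset)
  have "card C \<le> card (orth m) ^ card ?S"
  proof (rule card_PiE_rows[of _ ?T A])
    show "orth m \<subseteq> ?T \<rightarrow>\<^sub>E A" by (auto simp: orth_def len)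
    show "C \<subseteq> ?I' \<rightarrow>\<^sub>E A"
    proof
      fix M' assume "M' \<in> C"
      then obtain M where M: "M \<in> ?I \<rightarrow>\<^sub>E A" "M' = restrict M ?I'"
        unfolding C_def fibre_def mats_def by blast
      have "M x \<in> A" if "x \<in> ?I'" for x
        using that by (intro PiE_mem[OF M(1)]) auto
      then show "M' \<in> ?I' \<rightarrow>\<^sub>E A" unfolding M(2) restrict_PiE_iff by blast
    qed
    fix M' i assume "M' \<in> C" and i: "i \<in> ?S"
    then obtain M where M: "M \<in> mats d" "cofs d M = m" "M' = restrict M ?I'"
      by (auto simp: C_def fibre_def)
    have "(\<lambda>j\<in>?T. M' (i, j)) = (\<lambda>j\<in>?T. M (i, j))" using i M(3) by auto
    then show "(\<lambda>j\<in>?T. M' (i, j)) \<in> orth m" using row_in_orth[OF M(1), of i] i M(2) by simp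
  qed auto
  then have C: "card C \<le> card (orth m) ^ (d - 2)" using \<open>card ?S = d - 2\<close> by simp
  have "card (fibre d m) \<le> card A ^ (d - 2) * card C"
  proof (rule card_le_fibres[where f = "\<lambda>M. restrict M ?I'"])
    show "finite C" "(\<lambda>M. restrict M ?I') ` fibre d m \<subseteq> C" by (simp_all add: C_def)
    fix N assume "N \<in> C"
    then obtain M0 where M0: "M0 \<in> fibre d m" "restrict M0 ?I' = N" by (auto simp: C_def)
    define B where "B = {M \<in> fibre d m. restrict M ?I' = N}"
    \<comment> \<open>The coefficients of the expansion of the cofactor at column \<open>0\<close>
      along row \<open>1\<close>. They depend only on the rows from \<open>2\<close> on, which are
      constant on \<open>B\<close>.\<close>
    define c where "c l = pcof d (insert 1 {0}) ((\<lambda>_. 0)(1 := l)) M0" for l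
    have Bm: "M \<in> mats d" "M \<in> ?I \<rightarrow>\<^sub>E A" "M \<in> ?I \<rightarrow> carrier R" "cofs d M = m" if "M \<in> B" for M
      using that mats_carrier[of M d] unfolding B_def fibre_def mats_def by auto
    have Brow: "M (i, j) = M' (i, j)" if "M \<in> B" "M' \<in> B" "i \<in> ?S" "j \<in> ?T" for M M' i j
    proof -
      have "restrict M ?I' (i, j) = restrict M' ?I' (i, j)" using that by (simp add: B_def)
      then show ?thesis using that by simp
    qed
    have R1: "M (1, l) \<in> carrier R" if "M \<in> B" "l < d" for M l
      using Bm(3)[OF that(1)] that(2) d by (auto simp: Pi_iff)
    have M0B: "M0 \<in> B" using M0 by (simp add: B_def)
    have c_eq: "pcof d (insert 1 {0}) ((\<lambda>_. 0)(1 := l)) M = c l" if "M \<in> B" for M l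
      unfolding c_def
    proof (rule pcof_cong)
      show "M0 \<in> (?T - insert 1 {0}) \<times> ?T \<rightarrow> carrier R" using Bm(3)[OF M0B] by auto
      fix i j :: nat assume "i < d" "i \<notin> insert 1 {0}" "j < d"
      then show "M (i, j) = M0 (i, j)" by (intro Brow[OF that M0B]) auto
    qed simp
    have cC: "c l \<in> carrier R" for l
      unfolding c_def using Bm(3)[OF M0B] by (intro pcof_closed) auto
    have form1: "(\<Oplus>l\<in>?T. c l \<otimes> M (1, l)) = rev m ! 0" if M: "M \<in> B" for M
    proof -
      have "rev m ! 0 = pcof d {0} (\<lambda>_. 0) M"
        using rev_cofs_nth[of 0 d M] Bm(4)[OF M] d by simp
      also have "\<dots> = (\<Oplus>l\<in>?T. M (1, l) \<otimes> pcof d (insert 1 {0}) ((\<lambda>_. 0)(1 := l)) M)"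
        using d by (intro pcof_expand[OF Bm(3)[OF M]]) auto
      also have "\<dots> = (\<Oplus>l\<in>?T. c l \<otimes> M (1, l))"
      proof (rule finsum_cong')
        fix l assume "l \<in> ?T"
        then have "M (1, l) \<in> carrier R" using Bm(3)[OF M] d by auto
        then show "M (1, l) \<otimes> pcof d (insert 1 {0}) ((\<lambda>_. 0)(1 := l)) M = c l \<otimes> M (1, l)"
          using cC by (simp only: c_eq[OF M] m_comm)
      qed (use cC R1[OF M] in auto)
      finally show ?thesis ..
    qed
    have form2: "(\<Oplus>l\<in>?T. rev m ! l \<otimes> M (1, l)) = \<zero>" if M: "M \<in> B" for M
    proof -
      have "(\<lambda>j\<in>?T. M (1, j)) \<in> orth m"
        using row_in_orth[OF Bm(1)[OF M], of 1] Bm(4)[OF M] d by simp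
      then have "(\<Oplus>l\<in>?T. rev m ! l \<otimes> (\<lambda>j\<in>?T. M (1, j)) l) = \<zero>" by (simp add: orth_def len)
      moreover have "(\<Oplus>l\<in>?T. rev m ! l \<otimes> (\<lambda>j\<in>?T. M (1, j)) l) = (\<Oplus>l\<in>?T. rev m ! l \<otimes> M (1, l))"
        using rev_nth_nonzero[OF m] R1[OF M] by (intro finsum_cong') auto
      ultimately show ?thesis by simp
    qed
    \<comment> \<open>Column \<open>0\<close> is already taken by row \<open>0\<close>, so this
      equation does not contain the entry \<open>(1, 0)\<close>, whereas orthogonality does: the two
      equations are independent.\<close>
    have c0: "c 0 = \<zero>" unfolding c_def by (rule pcof_repeated_column[of 0 _ 1]) auto
    have "\<exists>l<d. c l \<noteq> \<zero>"
    proof (rule ccontr)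
      assume "\<not> (\<exists>l<d. c l \<noteq> \<zero>)"
      then have "(\<Oplus>l\<in>?T. c l \<otimes> M0 (1, l)) = (\<Oplus>l\<in>?T. \<zero>)"
        using R1[OF M0B] by (intro finsum_cong') auto
      then show False using form1[OF M0B] rev_nth_nonzero[OF m, of 0] d by (simp add: finsum_zero)
    qed
    then obtain j where j: "j < d" "c j \<noteq> \<zero>" by auto
    then have j0: "j \<noteq> 0" using c0 by metis
    have "card B \<le> card A ^ card ({1::nat} \<times> (?T - {0, j}))"
    proof (rule card_PiE_determined)
      show "B \<subseteq> ?I \<rightarrow>\<^sub>E A" using Bm(2) by blast
      show "{1::nat} \<times> (?T - {0, j}) \<subseteq> ?I" using d by auto
      fix M M' assume M: "M \<in> B" "M' \<in> B"
        and eq: "\<And>k. k \<in> {1::nat} \<times> (?T - {0, j}) \<Longrightarrow> M k = M' k"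
      have row: "(\<lambda>l. M (1, l)) \<in> ?T \<rightarrow> carrier R" "(\<lambda>l. M' (1, l)) \<in> ?T \<rightarrow> carrier R"
        using Bm(3)[OF M(1)] Bm(3)[OF M(2)] d by auto
      \<comment> \<open>The entry at \<open>j\<close> is found first, from the equation that lacks
        entry \<open>0\<close>; then orthogonality yields entry \<open>0\<close>, as
        \<open>rev m ! 0\<close> is nonzero.\<close>
      have ej: "M (1, j) = M' (1, j)"
      proof (rule linear_form_eq_imp_eq[of ?T j c "\<lambda>l. M (1, l)" "\<lambda>l. M' (1, l)"])
        show "c j \<in> Units R" using j cC by (simp add: Units_iff)
        show "(\<Oplus>l\<in>?T. c l \<otimes> M (1, l)) = (\<Oplus>l\<in>?T. c l \<otimes> M' (1, l))" using form1 M by simp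
        show "M (1, i) = M' (1, i)" if "i \<in> ?T - {j}" "c i \<noteq> \<zero>" for i
        proof -
          have "i \<noteq> 0" using that c0 by metis
          then show ?thesis using that by (intro eq) auto
        qed
      qed (use j cC row in auto)
      have e0: "M (1, 0) = M' (1, 0)"
      proof (rule linear_form_eq_imp_eq[of ?T 0 "\<lambda>l. rev m ! l" "\<lambda>l. M (1, l)" "\<lambda>l. M' (1, l)"])
        show "rev m ! 0 \<in> Units R" using rev_nth_nonzero[OF m, of 0] d by (simp add: Units_iff)
        show "(\<Oplus>l\<in>?T. rev m ! l \<otimes> M (1, l)) = (\<Oplus>l\<in>?T. rev m ! l \<otimes> M' (1, l))" using form2 M by simp
        show "M (1, i) = M' (1, i)" if "i \<in> ?T - {0}" for i
          using that ej by (cases "i = j") (auto intro: eq)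
        show "(\<lambda>l. rev m ! l) \<in> ?T \<rightarrow> carrier R" using rev_nth_nonzero[OF m] by auto
      qed (use d row in auto)
      show "M = M'"
      proof (rule PiE_ext[OF Bm(2)[OF M(1)] Bm(2)[OF M(2)]])
        fix x assume "x \<in> ?I"
        then obtain i l where x: "x = (i, l)" "i < d" "i \<noteq> 0" "l < d" by auto
        show "M x = M' x"
        proof (cases "i = 1")
          case True
          then show ?thesis using x ej e0 eq[of "(1, l)"] by (cases "l = j"; cases "l = 0") auto
        qed (use x Brow[OF M, of i l] in simp)
      qed
    qed auto
    moreover have "card ({1::nat} \<times> (?T - {0, j})) = d - 2"
      using j j0 d by (simp add: card_cartesian_product card_Diff_subset)
    ultimately show "card {M \<in> fibre d m. restrict M ?I' = N} \<le> card A ^ (d - 2)"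
      by (simp add: B_def)
  qed simp
  also have "\<dots> \<le> card A ^ (d - 2) * card (orth m) ^ (d - 2)" by (intro mult_le_mono2 C)
  finally show ?thesis .
qed

text \<open>The fibres over different multiples of \<open>m\<close> are disjoint, but
  \<open>orth\<close> is the same for all multiples; their union still consists of matrices with all
  \<open>d - 1\<close> rows in \<open>orth m\<close>.\<close>

lemma sum_fibre_scaled_le:
  assumes m: "m \<in> nzvecs d" and d: "d \<ge> 1"
  shows "(\<Sum>c\<in>carrier R - {\<zero>}. card (fibre d (map (\<lambda>x. c \<otimes> x) m))) \<le> card (orth m) ^ (d - 1)"
proof -
  let ?T = "{..<d}"
  let ?f = "\<lambda>c. fibre d (map (\<lambda>x. c \<otimes> x) m)"
  let ?K = "carrier R - {\<zero>}"
  have mv: "m \<in> vecs d" and len: "length m = d" using m nzvecs_subset by (auto simp: nzvecs_def)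
  have disj: "?f c \<inter> ?f c' = {}" if "c \<in> ?K" "c' \<in> ?K" "c \<noteq> c'" for c c'
  proof (rule ccontr)
    assume "?f c \<inter> ?f c' \<noteq> {}"
    then have "map (\<lambda>x. c \<otimes> x) m = map (\<lambda>x. c' \<otimes> x) m" by (auto simp: fibre_def)
    moreover obtain x xs where "m = x # xs" "x \<in> carrier R" "x \<noteq> \<zero>"
      using m d by (cases m) (auto simp: nzvecs_def)
    ultimately have "c \<otimes> x = c' \<otimes> x" "x \<in> Units R" by (auto simp: Units_iff)
    moreover have "x \<in> carrier R" "c \<in> carrier R" "c' \<in> carrier R"
      using that \<open>x \<in> carrier R\<close> by auto
    ultimately have "x \<otimes> c = x \<otimes> c'" using m_comm[of x c] m_comm[of x c'] by simp
    then have "c = c'"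
      using Units_l_cancel[of x c c'] \<open>x \<in> Units R\<close> that by blast
    then show False using that(3) by simp
  qed
  have "(\<Sum>c\<in>?K. card (?f c)) = card (\<Union>c\<in>?K. ?f c)"
    using disj by (intro card_UN_disjoint[symmetric]) auto
  also have "\<dots> \<le> card (orth m) ^ card (?T - {0})"
  proof (rule card_PiE_rows[of _ ?T A])
    show "orth m \<subseteq> ?T \<rightarrow>\<^sub>E A" by (auto simp: orth_def len)
    show "(\<Union>c\<in>?K. ?f c) \<subseteq> ((?T - {0}) \<times> ?T) \<rightarrow>\<^sub>E A" by (auto simp: fibre_def mats_def)
    fix M i assume "M \<in> (\<Union>c\<in>?K. ?f c)" and i: "i \<in> ?T - {0}"
    then obtain c where c: "c \<in> ?K" "M \<in> mats d" "cofs d M = map (\<lambda>x. c \<otimes> x) m"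
      by (auto simp: fibre_def)
    then show "(\<lambda>j\<in>?T. M (i, j)) \<in> orth m"
      using row_in_orth[OF c(2) i] orth_scale[OF mv] by auto
  qed auto
  finally show ?thesis using d by (simp add: card_Diff_singleton)
qed

section \<open>From determinants to vectors of cofactors\<close>

lemma det_ring_expand_row0:
  assumes X: "X \<in> carrier_mat d d" "elements_mat X \<subseteq> A" and d: "d \<ge> 1"
  defines "M \<equiv> restrict (\<lambda>ij. X $$ ij) (({..<d} - {0}) \<times> {..<d})"
  shows "det_ring R X = (\<Oplus>j\<in>{..<d}. pcof d {0} (\<lambda>_. j) M \<otimes> X $$ (0, j))"
proof -
  define F where "F = (\<lambda>ij. X $$ ij)"
  have dim: "dim_row X = d" "dim_col X = d" using X(1) by auto
  have XA: "X $$ (i, j) \<in> A" if "i < d" "j < d" for i j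
    using X that by blast
  have F: "F \<in> ({..<d} - {}) \<times> {..<d} \<rightarrow> carrier R" using XA by (auto simp: F_def)
  have F0: "F \<in> ({..<d} - {0}) \<times> {..<d} \<rightarrow> carrier R" using XA by (auto simp: F_def)
  have M0: "M \<in> ({..<d} - {0}) \<times> {..<d} \<rightarrow> carrier R" using XA by (auto simp: M_def)
  have "det_ring R X = pcof d {} (\<lambda>_. 0) F"
    unfolding det_ring_def pcof_def perms_fixing_def leib_term_def dim F_def
    by (simp add: atLeast0LessThan)
  also have "\<dots> = (\<Oplus>j\<in>{..<d}. F (0, j) \<otimes> pcof d {0} ((\<lambda>_. 0)(0 := j)) F)"
    using d by (intro pcof_expand[OF F]) auto
  also have "\<dots> = (\<Oplus>j\<in>{..<d}. pcof d {0} (\<lambda>_. j) M \<otimes> X $$ (0, j))"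
  proof (rule finsum_cong')
    fix j assume j: "j \<in> {..<d}"
    have "pcof d {0} ((\<lambda>_. 0)(0 := j)) F = pcof d {0} (\<lambda>_. j) M"
      by (rule pcof_cong[OF _ M0]) (auto simp: M_def F_def)
    moreover have "F (0, j) \<in> carrier R" using XA[of 0 j] d j by (auto simp: F_def)
    ultimately show "F (0, j) \<otimes> pcof d {0} ((\<lambda>_. 0)(0 := j)) F = pcof d {0} (\<lambda>_. j) M \<otimes> X $$ (0, j)"
      using m_comm[OF _ pcof_closed[OF M0]] by (simp add: F_def)
  next
    have "X $$ (0, j) \<in> carrier R" if "j < d" for j using XA[of 0 j] d that by auto
    then show "(\<lambda>j. pcof d {0} (\<lambda>_. j) M \<otimes> X $$ (0, j)) \<in> {..<d} \<rightarrow> carrier R"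
      using pcof_closed[OF M0] by auto
  qed simp
  finally show ?thesis .
qed

text \<open>A matrix is the pair of its lower rows \<open>M\<close> and its top row
  \<open>y\<close>, and its determinant is linear in \<open>y\<close> with the cofactors as
  coefficients.\<close>

lemma det_count_eq_sum:
  assumes d: "d \<ge> 1"
  shows "det_count R d A t = (\<Sum>M\<in>mats d. solcount d (\<lambda>j. pcof d {0} (\<lambda>_. j) M) t)"
proof -
  let ?I = "({..<d} - {0}) \<times> {..<d}"
  let ?Y = "\<lambda>M. {y \<in> {..<d} \<rightarrow>\<^sub>E A. (\<Oplus>j\<in>{..<d}. pcof d {0} (\<lambda>_. j) M \<otimes> y j) = t}"
  let ?D = "{X \<in> carrier_mat d d. elements_mat X \<subseteq> A \<and> det_ring R X = t}"
  let ?f = "\<lambda>X. (restrict (\<lambda>ij. X $$ ij) ?I, \<lambda>j\<in>{..<d}. X $$ (0, j))"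
  let ?g = "\<lambda>(M, y). mat d d (\<lambda>(i, j). if i = 0 then y j else M (i, j))"
  have XA: "X $$ (i, j) \<in> A" if "X \<in> carrier_mat d d" "elements_mat X \<subseteq> A" "i < d" "j < d" for X i j
    using that by blast
  have sum_restrict: "(\<Oplus>j\<in>{..<d}. pcof d {0} (\<lambda>_. j) M \<otimes> (\<lambda>j\<in>{..<d}. X $$ (0, j)) j)
      = (\<Oplus>j\<in>{..<d}. pcof d {0} (\<lambda>_. j) M \<otimes> X $$ (0, j))"
    if M: "M \<in> mats d" and X: "\<And>j. j < d \<Longrightarrow> X $$ (0, j) \<in> A" for M and X :: "'a mat"
    using X pcof_closed[OF mats_carrier[OF M]] by (intro finsum_cong') auto
  have "bij_betw ?f ?D (SIGMA M:mats d. ?Y M)"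
  proof (rule bij_betwI[where g = ?g])
    show "?f \<in> ?D \<rightarrow> (SIGMA M:mats d. ?Y M)"
    proof
      fix X assume X: "X \<in> ?D"
      define M where "M = restrict (\<lambda>ij. X $$ ij) ?I"
      have M: "M \<in> mats d" using X XA[of X] unfolding M_def mats_def by auto
      have "(\<Oplus>j\<in>{..<d}. pcof d {0} (\<lambda>_. j) M \<otimes> (\<lambda>j\<in>{..<d}. X $$ (0, j)) j) = t"
        using sum_restrict[OF M, of X] det_ring_expand_row0[of X d] X XA[of X 0] d by (simp add: M_def)
      moreover have "(\<lambda>j\<in>{..<d}. X $$ (0, j)) \<in> {..<d} \<rightarrow>\<^sub>E A" using X XA[of X 0] d by auto
      ultimately show "?f X \<in> (SIGMA M:mats d. ?Y M)" using M by (simp add: M_def)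
    qed
    show "?g \<in> (SIGMA M:mats d. ?Y M) \<rightarrow> ?D"
    proof
      fix p assume "p \<in> (SIGMA M:mats d. ?Y M)"
      then obtain M y where p: "p = (M, y)" and M: "M \<in> mats d" and y: "y \<in> {..<d} \<rightarrow>\<^sub>E A"
        and t: "(\<Oplus>j\<in>{..<d}. pcof d {0} (\<lambda>_. j) M \<otimes> y j) = t" by auto
      define X where "X = ?g (M, y)"
      have M_A: "M (i, j) \<in> A" if "i < d" "i \<noteq> 0" "j < d" for i j
        using M that unfolding mats_def by auto
      have yA: "y j \<in> A" if "j < d" for j using y that by auto
      have Xc: "X \<in> carrier_mat d d" by (simp add: X_def)
      have XA': "elements_mat X \<subseteq> A" unfolding elements_mat_def X_def using M_A yA by (auto split: if_splits)
      have rM: "restrict (\<lambda>ij. X $$ ij) ?I = M"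
      proof (rule PiE_ext[of _ ?I "\<lambda>_. A"])
        show "restrict (\<lambda>ij. X $$ ij) ?I \<in> ?I \<rightarrow>\<^sub>E A" using XA[OF Xc XA'] by auto
        show "M \<in> ?I \<rightarrow>\<^sub>E A" using M by (simp add: mats_def)
      qed (auto simp: X_def split: if_splits)
      have "det_ring R X = (\<Oplus>j\<in>{..<d}. pcof d {0} (\<lambda>_. j) M \<otimes> X $$ (0, j))"
        using det_ring_expand_row0[OF Xc XA' d] by (simp only: rM)
      also have "\<dots> = (\<Oplus>j\<in>{..<d}. pcof d {0} (\<lambda>_. j) M \<otimes> y j)"
        using yA d pcof_closed[OF mats_carrier[OF M]] by (intro finsum_cong') (auto simp: X_def)
      finally show "?g p \<in> ?D" using Xc XA' t unfolding p X_def[symmetric] by blast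
    qed
    show "?g (?f X) = X" if "X \<in> ?D" for X
      using that by (intro eq_matI) auto
    show "?f (?g p) = p" if "p \<in> (SIGMA M:mats d. ?Y M)" for p
    proof -
      obtain M y where p: "p = (M, y)" by (cases p)
      have M: "M \<in> ?I \<rightarrow>\<^sub>E A" and y: "y \<in> {..<d} \<rightarrow>\<^sub>E A"
        using that unfolding mats_def p by blast+
      have "restrict (\<lambda>ij. ?g p $$ ij) ?I = M"
      proof
        fix x show "restrict (\<lambda>ij. ?g p $$ ij) ?I x = M x"
          using PiE_arb[OF M, of x] by (cases x) (auto simp: p restrict_def split: if_splits)
      qed
      moreover have "(\<lambda>j\<in>{..<d}. ?g p $$ (0, j)) = y"
      proof
        fix x show "(\<lambda>j\<in>{..<d}. ?g p $$ (0, j)) x = y x"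
          using PiE_arb[OF y, of x] d by (auto simp: p restrict_def)
      qed
      ultimately show ?thesis unfolding p by (simp only: prod.inject)
    qed
  qed
  then have "det_count R d A t = card (SIGMA M:mats d. ?Y M)"
    unfolding det_count_def by (rule bij_betw_same_card)
  also have "\<dots> = (\<Sum>M\<in>mats d. card (?Y M))" by (rule card_SigmaI) auto
  finally show ?thesis by (simp add: solcount_def)
qed

text \<open>Every \<open>M\<close> contributes the same mean \<open>a ^ d / q\<close>, and these add
  up to exactly the main term.\<close>

lemma det_count_error_eq:
  assumes d: "d \<ge> 1" and t: "t \<in> carrier R"
  shows "real (det_count R d A t) - a ^ (d * d) / q = (\<Sum>M\<in>mats d. dev (cofs d M) t)"
proof -
  have "real (solcount d (\<lambda>j. pcof d {0} (\<lambda>_. j) M) t) = a ^ d / q + dev (cofs d M) t"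
    if M: "M \<in> mats d" for M
  proof -
    have "solcount d (\<lambda>j. pcof d {0} (\<lambda>_. j) M) t = solcount d (\<lambda>j. rev (cofs d M) ! j) t"
      using rev_cofs_nth rev_nth_carrier[OF cofs_vecs[OF M]] by (intro solcount_cong) auto
    then show ?thesis
      using solcount_eq_dev[of "cofs d M" t] cofs_vecs[OF M] t by (simp add: vecs_def)
  qed
  then have "real (det_count R d A t) = real (card (mats d)) * (a ^ d / q) + (\<Sum>M\<in>mats d. dev (cofs d M) t)"
    by (simp add: det_count_eq_sum[OF d] sum.distrib)
  also have "real (card (mats d)) * (a ^ d / q) = a ^ ((d - 1) * d + d) / q"
    by (simp add: card_mats a_def power_add)
  also have "(d - 1) * d + d = d * d" using d by (cases d) auto
  finally show ?thesis by simp
qed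

text \<open>By a union bound over the \<open>d\<close> cofactors, a proportion of at most
  \<open>d ^ 2 / a\<close> of the \<open>M\<close> is affected, and each deviates by at most
  \<open>a ^ d / a\<close>. Relative to the main term this is
  \<open>d ^ 2 * q / a\<^sup>2\<close>.\<close>

lemma sum_dev_zero_cofactor_le:
  assumes d: "d \<ge> 1" and t: "t \<in> carrier R" "t \<noteq> \<zero>"
  shows "a\<^sup>2 * (\<Sum>M\<in>{M \<in> mats d. cofs d M \<notin> nzvecs d}. \<bar>dev (cofs d M) t\<bar>) \<le> real d ^ 2 * a ^ (d * d)"
proof -
  let ?Z = "{M \<in> mats d. cofs d M \<notin> nzvecs d}"
  let ?Zj = "\<lambda>j. {M \<in> mats d. pcof d {0} (\<lambda>_. j) M = \<zero>}"
  have "?Z \<subseteq> (\<Union>j\<in>{..<d}. ?Zj j)"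
  proof
    fix M assume M: "M \<in> ?Z"
    then have "cofs d M \<in> vecs d" by (simp add: cofs_vecs)
    then have "\<zero> \<in> set (cofs d M)" using M by (auto simp: vecs_def nzvecs_def)
    then show "M \<in> (\<Union>j\<in>{..<d}. ?Zj j)" using M by (auto simp: cofs_def)
  qed
  then have "card ?Z \<le> card (\<Union>j\<in>{..<d}. ?Zj j)" by (intro card_mono) auto
  also have "\<dots> \<le> (\<Sum>j\<in>{..<d}. card (?Zj j))" by (rule card_UN_le) simp
  finally have "card A * card ?Z \<le> (\<Sum>j\<in>{..<d}. card A * card (?Zj j))"
    unfolding sum_distrib_left[symmetric] by (rule mult_le_mono2)
  also have "\<dots> \<le> (\<Sum>j\<in>{..<d}. (d - 1) * card A ^ ((d - 1) * d))"
    unfolding mats_def using d by (intro sum_mono pcof_zero_count) (auto simp: card_Diff_singleton)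
  also have "\<dots> = d * ((d - 1) * card A ^ ((d - 1) * d))" by simp
  also have "\<dots> \<le> d * (d * card A ^ ((d - 1) * d))" by (intro mult_le_mono) auto
  finally have "real (card A * card ?Z) \<le> real (d * (d * card A ^ ((d - 1) * d)))" by (rule of_nat_mono)
  then have Z: "a * real (card ?Z) \<le> real d ^ 2 * a ^ ((d - 1) * d)"
    by (simp add: a_def power2_eq_square mult.assoc)
  have "a\<^sup>2 * (\<Sum>M\<in>?Z. \<bar>dev (cofs d M) t\<bar>) = a * (\<Sum>M\<in>?Z. a * \<bar>dev (cofs d M) t\<bar>)"
    by (simp add: sum_distrib_left power2_eq_square mult.assoc)
  also have "\<dots> \<le> a * (\<Sum>M\<in>?Z. a ^ d)"
    using t cofs_vecs by (intro mult_left_mono sum_mono abs_dev_le) auto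
  also have "\<dots> = (a * real (card ?Z)) * a ^ d" by simp
  also have "\<dots> \<le> real d ^ 2 * a ^ ((d - 1) * d) * a ^ d" by (intro mult_right_mono Z) simp
  also have "\<dots> = real d ^ 2 * a ^ ((d - 1) * d + d)" by (simp add: power_add)
  also have "(d - 1) * d + d = d * d" using d by (cases d) auto
  finally show ?thesis .
qed

section \<open>Moments of the fibre sizes and heavy vectors\<close>

definition fibre_card :: "nat \<Rightarrow> 'a list \<Rightarrow> real" where "fibre_card d m = real (card (fibre d m))"

definition orth_card :: "'a list \<Rightarrow> real" where "orth_card m = real (card (orth m))"

text \<open>What remains of the sum of the squares of \<open>fibre_card\<close> when only one factor
  is replaced by the bound of \<open>card_fibre_le\<close>, up to \<open>a ^ (d - 2)\<close>. The
  other factor is kept, so that the total number of matrices or the average over multiples can still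
  be used.\<close>

definition orth_moment :: "nat \<Rightarrow> real" where
  "orth_moment d = (\<Sum>m\<in>nzvecs d. fibre_card d m * orth_card m ^ (d - 2))"

lemma fibre_card_nonneg [simp]: "fibre_card d m \<ge> 0" and orth_card_nonneg [simp]: "orth_card m \<ge> 0"
  by (simp_all add: fibre_card_def orth_card_def)

lemma orth_moment_nonneg: "orth_moment d \<ge> 0"
  unfolding orth_moment_def by (intro sum_nonneg) simp

lemma sum_over_nzvecs:
  fixes g :: "'a list \<Rightarrow> real"
  shows "(\<Sum>M\<in>{M \<in> mats d. cofs d M \<in> nzvecs d}. g (cofs d M)) = (\<Sum>m\<in>nzvecs d. fibre_card d m * g m)"
proof -
  let ?G = "{M \<in> mats d. cofs d M \<in> nzvecs d}"
  have "(\<Sum>M\<in>?G. g (cofs d M)) = (\<Sum>m\<in>nzvecs d. \<Sum>M\<in>{M \<in> ?G. cofs d M = m}. g (cofs d M))"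
    by (intro sum.group[symmetric]) auto
  also have "\<dots> = (\<Sum>m\<in>nzvecs d. \<Sum>M\<in>fibre d m. g m)"
    by (intro sum.cong) (auto simp: fibre_def)
  finally show ?thesis by (simp add: fibre_card_def)
qed

lemma sum_fibre_card_le: "(\<Sum>m\<in>nzvecs d. fibre_card d m) \<le> a ^ ((d - 1) * d)"
proof -
  have "(\<Sum>m\<in>nzvecs d. fibre_card d m) = real (card {M \<in> mats d. cofs d M \<in> nzvecs d})"
    using sum_over_nzvecs[of "\<lambda>_. 1" d] by simp
  also have "\<dots> \<le> real (card (mats d))" by (intro of_nat_mono card_mono) auto
  finally show ?thesis by (simp add: card_mats a_def)
qed

lemma main_sum_le:
  assumes d: "d \<ge> 2" and t: "t \<in> carrier R" "t \<noteq> \<zero>"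
  shows "(\<Sum>M\<in>{M \<in> mats d. cofs d M \<in> nzvecs d}. dev (cofs d M) t)\<^sup>2
      \<le> a ^ (d - 2) * orth_moment d * (2 * q ^ d * a ^ d / q)"
proof -
  have fibre: "fibre_card d m \<le> a ^ (d - 2) * orth_card m ^ (d - 2)" if "m \<in> nzvecs d" for m
  proof -
    have "real (card (fibre d m)) \<le> real (card A ^ (d - 2) * card (orth m) ^ (d - 2))"
      by (intro of_nat_mono card_fibre_le that d)
    then show ?thesis by (simp add: fibre_card_def orth_card_def a_def)
  qed
  have "(\<Sum>M\<in>{M \<in> mats d. cofs d M \<in> nzvecs d}. dev (cofs d M) t)\<^sup>2
      = (\<Sum>m\<in>nzvecs d. fibre_card d m * dev m t)\<^sup>2"
    by (simp only: sum_over_nzvecs[of "\<lambda>m. dev m t"])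
  also have "\<dots> \<le> (\<Sum>m\<in>nzvecs d. (fibre_card d m)\<^sup>2) * (\<Sum>m\<in>nzvecs d. (dev m t)\<^sup>2)"
    by (rule Cauchy_Schwarz_sum)
  also have "\<dots> \<le> (a ^ (d - 2) * orth_moment d) * (2 * q ^ d * a ^ d / q)"
  proof (rule mult_mono)
    have "(\<Sum>m\<in>nzvecs d. (fibre_card d m)\<^sup>2) \<le> (\<Sum>m\<in>nzvecs d. fibre_card d m * (a ^ (d - 2) * orth_card m ^ (d - 2)))"
      unfolding power2_eq_square by (intro sum_mono mult_left_mono fibre) auto
    then show "(\<Sum>m\<in>nzvecs d. (fibre_card d m)\<^sup>2) \<le> a ^ (d - 2) * orth_moment d"
      unfolding orth_moment_def sum_distrib_left by (simp add: mult_ac)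
    have "(\<Sum>m\<in>nzvecs d. (dev m t)\<^sup>2) \<le> (\<Sum>m\<in>vecs d. (dev m t)\<^sup>2)"
      using nzvecs_subset by (intro sum_mono2) auto
    also have "\<dots> \<le> 2 * q ^ d * a ^ d / q" by (rule second_moment_nonzero[OF t])
    finally show "(\<Sum>m\<in>nzvecs d. (dev m t)\<^sup>2) \<le> 2 * q ^ d * a ^ d / q" .
  qed (auto intro: sum_nonneg simp: orth_moment_nonneg)
  finally show ?thesis .
qed

lemma det_count_error_le:
  assumes d: "d \<ge> 2" and t: "t \<in> carrier R" "t \<noteq> \<zero>" and a: "a > 0"
  shows "\<bar>real (det_count R d A t) - a ^ (d * d) / q\<bar>
    \<le> real d ^ 2 * a ^ (d * d) / a\<^sup>2 + sqrt (a ^ (d - 2) * orth_moment d * (2 * q ^ d * a ^ d / q))"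
proof -
  let ?Z = "{M \<in> mats d. cofs d M \<notin> nzvecs d}" and ?G = "{M \<in> mats d. cofs d M \<in> nzvecs d}"
  have "mats d = ?G \<union> ?Z" "?G \<inter> ?Z = {}" by auto
  then have "(\<Sum>M\<in>mats d. dev (cofs d M) t) = (\<Sum>M\<in>?G. dev (cofs d M) t) + (\<Sum>M\<in>?Z. dev (cofs d M) t)"
    using sum.union_disjoint[of ?G ?Z "\<lambda>M. dev (cofs d M) t"] finite_mats by simp
  moreover have "\<bar>\<Sum>M\<in>?G. dev (cofs d M) t\<bar> \<le> sqrt (a ^ (d - 2) * orth_moment d * (2 * q ^ d * a ^ d / q))"
    using main_sum_le[OF d t] by (intro real_le_rsqrt) (simp only: power2_abs)
  moreover have "\<bar>\<Sum>M\<in>?Z. dev (cofs d M) t\<bar> \<le> real d ^ 2 * a ^ (d * d) / a\<^sup>2"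
  proof -
    have "\<bar>\<Sum>M\<in>?Z. dev (cofs d M) t\<bar> \<le> (\<Sum>M\<in>?Z. \<bar>dev (cofs d M) t\<bar>)" by (rule sum_abs)
    also have "\<dots> \<le> real d ^ 2 * a ^ (d * d) / a\<^sup>2"
      using sum_dev_zero_cofactor_le[of d t] d t a by (simp add: field_simps)
    finally show ?thesis .
  qed
  ultimately show ?thesis using det_count_error_eq[of d t] d t by linarith
qed

definition heavy :: "nat \<Rightarrow> 'a list set" where
  "heavy d = {m \<in> nzvecs d. 2 * a ^ d / q < orth_card m}"

lemma heavy_subset: "heavy d \<subseteq> nzvecs d" by (auto simp: heavy_def)

lemma finite_heavy [simp]: "finite (heavy d)"
  using heavy_subset finite_nzvecs finite_subset by blast

text \<open>A count above twice its mean consists for more than half of the deviation.\<close>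

lemma heavy_dev:
  assumes "m \<in> heavy d"
  shows "orth_card m \<le> 2 * dev m \<zero>" "(orth_card m)\<^sup>2 \<le> 4 * (dev m \<zero>)\<^sup>2"
proof -
  have "m \<in> vecs d" using assms nzvecs_subset by (auto simp: heavy_def)
  then have "orth_card m = a ^ d / q + dev m \<zero>" by (simp add: orth_card_def card_orth)
  moreover have "2 * a ^ d / q < orth_card m" using assms by (simp add: heavy_def)
  ultimately show 1: "orth_card m \<le> 2 * dev m \<zero>" by simp
  have "(orth_card m)\<^sup>2 \<le> (2 * dev m \<zero>)\<^sup>2" by (intro power_mono 1) simp
  then show "(orth_card m)\<^sup>2 \<le> 4 * (dev m \<zero>)\<^sup>2" by (simp add: power_mult_distrib)
qed

lemma orth_card_le:
  assumes m: "m \<in> nzvecs d" and d: "d \<ge> 1" and a: "a > 0"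
  shows "orth_card m \<le> a ^ (d - 1)"
proof -
  have "card A * solcount d (\<lambda>j. rev m ! j) \<zero> \<le> card A ^ d"
    using rev_nth_nonzero[OF m] d by (intro solcount_le[of _ _ 0]) auto
  then have "real (card A * card (orth m)) \<le> real (card A ^ d)"
    using m by (intro of_nat_mono) (simp add: orth_def solcount_def nzvecs_def)
  then have "a * orth_card m \<le> a ^ d" by (simp add: a_def orth_card_def)
  also have "\<dots> = a * a ^ (d - 1)" using d by (cases d) auto
  finally show ?thesis using a by simp
qed

lemma scale_nzvecs:
  assumes "c \<in> carrier R" "c \<noteq> \<zero>" "m \<in> nzvecs d"
  shows "map (\<lambda>x. c \<otimes> x) m \<in> nzvecs d"
  using assms by (auto simp: nzvecs_def integral_iff subset_iff)

lemma orth_card_scale: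
  assumes "c \<in> carrier R" "c \<noteq> \<zero>" "m \<in> nzvecs d"
  shows "orth_card (map (\<lambda>x. c \<otimes> x) m) = orth_card m"
  unfolding orth_card_def using orth_scale[OF subsetD[OF nzvecs_subset assms(3)] assms(1,2)] by simp

lemma sum_heavy_scale:
  fixes g :: "'a list \<Rightarrow> real"
  assumes "c \<in> carrier R" "c \<noteq> \<zero>"
  shows "(\<Sum>m\<in>heavy d. g (map (\<lambda>x. c \<otimes> x) m)) = (\<Sum>m\<in>heavy d. g m)"
proof -
  have c: "c \<in> Units R" using assms by (simp add: field_Units)
  then have i: "inv c \<in> carrier R" "inv c \<noteq> \<zero>"
    using Units_inv_Units[OF c] by (simp_all add: field_Units)
  have s: "inv c \<otimes> (c \<otimes> x) = x" "c \<otimes> (inv c \<otimes> x) = x" if "x \<in> carrier R" for x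
    using that c assms by (simp_all add: m_assoc[symmetric] Units_l_inv Units_r_inv)
  have hv: "map (\<lambda>x. e \<otimes> x) m \<in> heavy d" if "m \<in> heavy d" "e \<in> carrier R" "e \<noteq> \<zero>" for e m
    using that scale_nzvecs[of e m d] orth_card_scale[of e m d] by (simp add: heavy_def)
  have C: "set m \<subseteq> carrier R" if "m \<in> heavy d" for m
    using that by (auto simp: heavy_def nzvecs_def)
  have inv: "map (\<lambda>x. inv c \<otimes> x) (map (\<lambda>x. c \<otimes> x) m) = m" "map (\<lambda>x. c \<otimes> x) (map (\<lambda>x. inv c \<otimes> x) m) = m"
    if "m \<in> heavy d" for m
    using C[OF that] s by (auto simp: o_def subset_iff intro!: map_idI)
  show ?thesis
    by (rule sum.reindex_bij_witness[where i = "map (\<lambda>x. inv c \<otimes> x)" and j = "map (\<lambda>x. c \<otimes> x)"])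
       (simp_all only: inv hv i assms not_False_eq_True)
qed

text \<open>Both the heavy vectors and \<open>orth_card\<close> are invariant under scaling, and all the rows whose
  cofactor vector is some multiple of \<open>m\<close> lie in \<open>orth m\<close>: averaging over the multiples gains a factor
  of \<open>q\<close>.\<close>

lemma sum_heavy_le:
  assumes d: "d \<ge> 2"
  shows "(\<Sum>m\<in>heavy d. fibre_card d m * orth_card m ^ (d - 2)) \<le> 2 / q * (\<Sum>m\<in>heavy d. orth_card m ^ (2 * d - 3))"
proof -
  let ?X = "\<Sum>m\<in>heavy d. fibre_card d m * orth_card m ^ (d - 2)"
  let ?K = "carrier R - {\<zero>}"
  have X: "?X \<ge> 0" by (intro sum_nonneg) simp
  have "card ?K = card (carrier R) - 1" by (simp add: card_Diff_singleton)
  moreover have "card (carrier R) \<ge> 2" using q_ge_2 by (simp add: q_def)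
  ultimately have cK: "real (card ?K) = q - 1" by (simp add: q_def of_nat_diff)
  \<comment> \<open>There are \<open>q - 1\<close> nonzero multiples;
    \<open>q / 2 \<le> q - 1\<close> causes the factor 2 in the claim.\<close>
  have "q / 2 * ?X \<le> (q - 1) * ?X" using q_ge_2 X by (intro mult_right_mono) auto
  also have "\<dots> = (\<Sum>c\<in>?K. ?X)" by (simp only: sum_constant cK)
  also have "\<dots> = (\<Sum>c\<in>?K. \<Sum>m\<in>heavy d. fibre_card d (map (\<lambda>x. c \<otimes> x) m) * orth_card m ^ (d - 2))"
  proof (rule sum.cong[OF refl])
    fix c assume c: "c \<in> ?K"
    have "?X = (\<Sum>m\<in>heavy d. fibre_card d (map (\<lambda>x. c \<otimes> x) m) * orth_card (map (\<lambda>x. c \<otimes> x) m) ^ (d - 2))"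
      using c by (intro sum_heavy_scale[of c "\<lambda>m. fibre_card d m * orth_card m ^ (d - 2)", symmetric]) auto
    also have "\<dots> = (\<Sum>m\<in>heavy d. fibre_card d (map (\<lambda>x. c \<otimes> x) m) * orth_card m ^ (d - 2))"
      using c by (intro sum.cong refl) (simp add: orth_card_scale[OF _ _ subsetD[OF heavy_subset]])
    finally show "?X = \<dots>" .
  qed
  also have "\<dots> = (\<Sum>m\<in>heavy d. (\<Sum>c\<in>?K. fibre_card d (map (\<lambda>x. c \<otimes> x) m)) * orth_card m ^ (d - 2))"
    by (subst sum.swap) (simp add: sum_distrib_right)
  also have "\<dots> \<le> (\<Sum>m\<in>heavy d. orth_card m ^ (d - 1) * orth_card m ^ (d - 2))"
  proof (intro sum_mono mult_right_mono)
    fix m assume "m \<in> heavy d"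
    then have "real (\<Sum>c\<in>?K. card (fibre d (map (\<lambda>x. c \<otimes> x) m))) \<le> real (card (orth m) ^ (d - 1))"
      using heavy_subset d by (intro of_nat_mono sum_fibre_scaled_le) auto
    then show "(\<Sum>c\<in>?K. fibre_card d (map (\<lambda>x. c \<otimes> x) m)) \<le> orth_card m ^ (d - 1)"
      by (simp add: fibre_card_def orth_card_def)
  qed auto
  also have "\<dots> = (\<Sum>m\<in>heavy d. orth_card m ^ (2 * d - 3))"
  proof -
    have "(d - 1) + (d - 2) = 2 * d - 3" using d by simp
    then show ?thesis by (simp only: power_add[symmetric])
  qed
  finally show ?thesis using q_ge_2 by (simp add: field_simps)
qed

text \<open>Off \<open>heavy d\<close> the power is bounded pointwise and the fibres together have
  at most as many elements as \<open>mats d\<close>; the heavy part is left to the moments at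
  zero.\<close>

lemma orth_moment_le:
  "orth_moment d \<le> (2 * a ^ d / q) ^ (d - 2) * a ^ ((d - 1) * d) + (\<Sum>m\<in>heavy d. fibre_card d m * orth_card m ^ (d - 2))"
proof -
  have "orth_moment d = (\<Sum>m\<in>nzvecs d - heavy d. fibre_card d m * orth_card m ^ (d - 2)) + (\<Sum>m\<in>heavy d. fibre_card d m * orth_card m ^ (d - 2))"
    unfolding orth_moment_def by (rule sum.subset_diff[OF heavy_subset]) simp
  moreover have "(\<Sum>m\<in>nzvecs d - heavy d. fibre_card d m * orth_card m ^ (d - 2))
      \<le> (\<Sum>m\<in>nzvecs d - heavy d. fibre_card d m * (2 * a ^ d / q) ^ (d - 2))"
    by (intro sum_mono mult_left_mono power_mono) (auto simp: heavy_def not_less)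
  moreover have "\<dots> = (2 * a ^ d / q) ^ (d - 2) * (\<Sum>m\<in>nzvecs d - heavy d. fibre_card d m)"
    by (subst mult.commute, rule sum_distrib_right[symmetric])
  moreover have "\<dots> \<le> (2 * a ^ d / q) ^ (d - 2) * (\<Sum>m\<in>nzvecs d. fibre_card d m)"
    using q_ge_2 by (intro mult_left_mono sum_mono2) auto
  moreover have "\<dots> \<le> (2 * a ^ d / q) ^ (d - 2) * a ^ ((d - 1) * d)"
    using q_ge_2 by (intro mult_left_mono sum_fibre_card_le) auto
  ultimately show ?thesis by linarith
qed

text \<open>For \<open>d = 2\<close> the exponent \<open>d - 2\<close> is zero, and only the number
  of choices of the other row enters.\<close>

lemma orth_moment_2_le: "orth_moment 2 \<le> a ^ 2"
  using sum_fibre_card_le[of 2] by (simp add: orth_moment_def)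

text \<open>Here \<open>2 * d - 3 = 3\<close>: one factor is at most \<open>a ^ 2\<close>, the other
  two pass to \<open>dev\<close> at the cost of 4, and 176 = 2 * 4 * 22.\<close>

lemma orth_moment_3_le:
  assumes "q \<le> a\<^sup>2" "a > 0"
  shows "orth_moment 3 \<le> 2 * a ^ 9 / q + 176 * a ^ 6 * q"
proof -
  have "(\<Sum>m\<in>heavy 3. orth_card m ^ 3) \<le> (\<Sum>m\<in>heavy 3. a ^ 2 * (4 * (dev m \<zero>)\<^sup>2))"
  proof (rule sum_mono)
    fix m assume m: "m \<in> heavy 3"
    then have "orth_card m \<le> a ^ (3 - 1)" using heavy_subset assms by (intro orth_card_le) auto
    then have "orth_card m * (orth_card m)\<^sup>2 \<le> a ^ 2 * (4 * (dev m \<zero>)\<^sup>2)"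
      by (intro mult_mono heavy_dev[OF m]) auto
    then show "orth_card m ^ 3 \<le> a ^ 2 * (4 * (dev m \<zero>)\<^sup>2)" by (simp add: eval_nat_numeral)
  qed
  also have "\<dots> = 4 * a ^ 2 * (\<Sum>m\<in>heavy 3. (dev m \<zero>)\<^sup>2)" by (simp add: sum_distrib_left mult_ac)
  also have "\<dots> \<le> 4 * a ^ 2 * (\<Sum>m\<in>vecs 3. (dev m \<zero>)\<^sup>2)"
    using heavy_subset nzvecs_subset by (intro mult_left_mono sum_mono2) auto
  also have "\<dots> \<le> 4 * a ^ 2 * (22 * a ^ 4 * q\<^sup>2)"
    by (intro mult_left_mono second_moment_zero_3 assms) auto
  finally have "2 / q * (\<Sum>m\<in>heavy 3. orth_card m ^ 3) \<le> 2 / q * (4 * a ^ 2 * (22 * a ^ 4 * q\<^sup>2))"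
    using q_ge_2 by (intro mult_left_mono) auto
  also have "\<dots> = 176 * a ^ 6 * q"
    using q_ge_2 by (simp add: field_simps eval_nat_numeral)
  finally show ?thesis
    using orth_moment_le[of 3] sum_heavy_le[of 3] by (simp add: eval_nat_numeral mult_ac)
qed

text \<open>Of the \<open>2 * k + 5\<close> factors one is bounded by \<open>a ^ (k + 3)\<close>;
  the remaining even number passes to \<open>dev\<close> and is exactly the order of
  \<open>high_moment_zero\<close>.\<close>

lemma orth_moment_ge_4_le:
  assumes "a > 0"
  shows "orth_moment (k + 4) \<le> (2 * a ^ (k + 4) / q) ^ (k + 2) * a ^ ((k + 3) * (k + 4))
    + 2 * 4 ^ (k + 2) * a ^ (2 * (k + 2) * (k + 3)) * q ^ (k + 3)"
proof -
  have "(\<Sum>m\<in>heavy (k + 4). orth_card m ^ (2 * k + 5))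
      \<le> (\<Sum>m\<in>heavy (k + 4). a ^ (k + 3) * (4 ^ (k + 2) * ((dev m \<zero>)\<^sup>2) ^ (k + 2)))"
  proof (rule sum_mono)
    fix m assume m: "m \<in> heavy (k + 4)"
    then have "orth_card m \<le> a ^ (k + 4 - 1)" using heavy_subset assms by (intro orth_card_le) auto
    then have 1: "orth_card m \<le> a ^ (k + 3)" by (simp add: add.commute)
    have "((orth_card m)\<^sup>2) ^ (k + 2) \<le> (4 * (dev m \<zero>)\<^sup>2) ^ (k + 2)"
      by (intro power_mono heavy_dev[OF m]) simp
    then have "orth_card m * ((orth_card m)\<^sup>2) ^ (k + 2) \<le> a ^ (k + 3) * (4 * (dev m \<zero>)\<^sup>2) ^ (k + 2)"
      by (intro mult_mono 1) auto
    moreover have "orth_card m ^ (2 * k + 5) = orth_card m * ((orth_card m)\<^sup>2) ^ (k + 2)"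
    proof -
      have "2 * k + 5 = Suc (2 * (k + 2))" by simp
      then show ?thesis by (simp only: power_Suc power_mult)
    qed
    ultimately show "orth_card m ^ (2 * k + 5) \<le> a ^ (k + 3) * (4 ^ (k + 2) * ((dev m \<zero>)\<^sup>2) ^ (k + 2))"
      by (simp only: power_mult_distrib)
  qed
  also have "\<dots> = a ^ (k + 3) * 4 ^ (k + 2) * (\<Sum>m\<in>heavy (k + 4). ((dev m \<zero>)\<^sup>2) ^ (k + 2))"
    by (simp only: sum_distrib_left mult.assoc)
  also have "\<dots> \<le> a ^ (k + 3) * 4 ^ (k + 2) * (\<Sum>m\<in>nzvecs (k + 4). ((dev m \<zero>)\<^sup>2) ^ (k + 2))"
    using heavy_subset by (intro mult_left_mono sum_mono2) auto
  also have "\<dots> \<le> a ^ (k + 3) * 4 ^ (k + 2)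
      * (a ^ (2 * k + (2 * k + 3) * (k + 1)) * (q * (q * a\<^sup>2) ^ (k + 3)))"
    by (intro mult_left_mono high_moment_zero) auto
  finally have "2 / q * (\<Sum>m\<in>heavy (k + 4). orth_card m ^ (2 * k + 5))
      \<le> 2 / q * (a ^ (k + 3) * 4 ^ (k + 2)
      * (a ^ (2 * k + (2 * k + 3) * (k + 1)) * (q * (q * a\<^sup>2) ^ (k + 3))))"
    using q_ge_2 by (intro mult_left_mono) auto
  also have "\<dots> = 2 * 4 ^ (k + 2) * a ^ (2 * (k + 2) * (k + 3)) * q ^ (k + 3)"
  proof -
    have "a ^ (k + 3) * a ^ (2 * k + (2 * k + 3) * (k + 1)) * a ^ (2 * (k + 3)) = a ^ (2 * (k + 2) * (k + 3))"
      unfolding power_add[symmetric] by (rule arg_cong[of _ _ "\<lambda>n. a ^ n"]) (simp add: algebra_simps)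
    moreover have "(q * a\<^sup>2) ^ (k + 3) = q ^ (k + 3) * a ^ (2 * (k + 3))"
      by (simp only: power_mult_distrib power_mult)
    moreover have "2 / q * (x * y * (z * (q * (u * v)))) = 2 * y * (x * z * v) * u" for x y z u v
      using q_ge_2 by simp
    ultimately show ?thesis by simp
  qed
  finally have "2 / q * (\<Sum>m\<in>heavy (k + 4). orth_card m ^ (2 * k + 5))
      \<le> 2 * 4 ^ (k + 2) * a ^ (2 * (k + 2) * (k + 3)) * q ^ (k + 3)" .
  moreover have "2 * (k + 4) - 3 = 2 * k + 5" "k + 4 - 2 = k + 2" "k + 4 - 1 = k + 3" by auto
  ultimately show ?thesis
    using orth_moment_le[of "k + 4"] sum_heavy_le[of "k + 4"] by (simp only:) linarith
qed

end

section \<open>The relative error\<close>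

text \<open>Bounds the square of the relative error from the matrices without vanishing cofactors:
  first the ordinary vectors, then the heavy ones. The constants collect those of the
  \<open>orth_moment\<close> bounds and the 2 of \<open>second_moment_nonzero\<close>; for instance
  352 = 2 * 176.\<close>

definition rel_err :: "nat \<Rightarrow> real \<Rightarrow> real \<Rightarrow> real" where
  "rel_err d q a = 2 ^ (d - 1) * q ^ 3 / a ^ (d + 2)
    + (if d = 2 then 0 else if d = 3 then 352 * q ^ 5 / a ^ 8
       else 4 ^ (d - 1) * q ^ (2 * d) / a ^ (4 * d - 2))"

context finite_field_subset
begin

lemma orth_moment_le_rel_err:
  assumes d: "d \<ge> 2" and a: "a > 0" and q: "q \<le> a\<^sup>2"
  shows "q\<^sup>2 * (a ^ (d - 2) * orth_moment d * (2 * q ^ d * a ^ d / q)) \<le> rel_err d q a * (a ^ (d * d))\<^sup>2"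
proof -
  have q0: "q > 0" using q_ge_2 by simp
  consider "d = 2" | "d = 3" | k where "d = k + 4"
  proof -
    consider "d = 2" | "d = 3" | "4 \<le> d" using d by linarith
    then show thesis
    proof cases
      case 3
      then obtain k where "d = 4 + k" using le_Suc_ex by blast
      then show thesis using that(3)[of k] by simp
    qed (use that in auto)
  qed
  then show ?thesis
  proof cases
    case 1
    have "q\<^sup>2 * (a ^ (d - 2) * orth_moment d * (2 * q ^ d * a ^ d / q)) \<le> q\<^sup>2 * (a ^ (d - 2) * a ^ 2 * (2 * q ^ d * a ^ d / q))"
      using a q0 orth_moment_2_le 1 by (intro mult_left_mono mult_right_mono) auto
    also have "\<dots> = rel_err d q a * (a ^ (d * d))\<^sup>2"
      using a q0 1 by (simp add: rel_err_def field_simps eval_nat_numeral)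
    finally show ?thesis .
  next
    case 2
    have "q\<^sup>2 * (a ^ (d - 2) * orth_moment d * (2 * q ^ d * a ^ d / q))
        \<le> q\<^sup>2 * (a ^ (d - 2) * (2 * a ^ 9 / q + 176 * a ^ 6 * q) * (2 * q ^ d * a ^ d / q))"
      using a q0 orth_moment_3_le[OF q a] 2 by (intro mult_left_mono mult_right_mono) auto
    also have "\<dots> = rel_err d q a * (a ^ (d * d))\<^sup>2"
      using a q0 2 by (simp add: rel_err_def field_simps eval_nat_numeral)
    finally show ?thesis .
  next
    case (3 k)
    let ?B1 = "(2 * a ^ (k + 4) / q) ^ (k + 2) * a ^ ((k + 3) * (k + 4))"
    let ?B2 = "2 * 4 ^ (k + 2) * a ^ (2 * (k + 2) * (k + 3)) * q ^ (k + 3)"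
    let ?r = "a ^ ((k + 4) * (k + 4))"
    have "q\<^sup>2 * (a ^ (d - 2) * orth_moment d * (2 * q ^ d * a ^ d / q))
        \<le> q\<^sup>2 * (a ^ (d - 2) * (?B1 + ?B2) * (2 * q ^ d * a ^ d / q))"
      using a q0 orth_moment_ge_4_le[OF a, of k] 3 by (intro mult_left_mono mult_right_mono) auto
    also have "\<dots> = q\<^sup>2 * (a ^ (k + 2) * ?B1 * (2 * q ^ (k + 3) * a ^ (k + 4)))
        + q\<^sup>2 * (a ^ (k + 2) * ?B2 * (2 * q ^ (k + 3) * a ^ (k + 4)))"
      using q0 3 by (simp add: algebra_simps eval_nat_numeral)
    also have "q\<^sup>2 * (a ^ (k + 2) * ?B1 * (2 * q ^ (k + 3) * a ^ (k + 4)))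
        = 2 ^ (k + 3) * q ^ 3 / a ^ (k + 6) * ?r\<^sup>2"
    proof -
      have "a ^ (k + 2) * a ^ ((k + 4) * (k + 2)) * a ^ ((k + 3) * (k + 4)) * a ^ (k + 4) * a ^ (k + 6) = ?r\<^sup>2"
        unfolding power_add[symmetric] power_mult[symmetric]
        by (rule arg_cong[of _ _ "\<lambda>n. a ^ n"]) (simp add: algebra_simps)
      moreover have "?B1 = 2 ^ (k + 2) * a ^ ((k + 4) * (k + 2)) / q ^ (k + 2) * a ^ ((k + 3) * (k + 4))"
        by (simp only: power_divide power_mult_distrib power_mult)
      moreover have "q\<^sup>2 * q ^ (k + 3) = q ^ 3 * q ^ (k + 2)" by (simp add: eval_nat_numeral)
      ultimately show ?thesis using a q0
        by (simp add: field_simps del: power_Suc) (simp add: eval_nat_numeral mult_ac)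
    qed
    also have "q\<^sup>2 * (a ^ (k + 2) * ?B2 * (2 * q ^ (k + 3) * a ^ (k + 4)))
        = 4 ^ (k + 3) * q ^ (2 * (k + 4)) / a ^ (4 * k + 14) * ?r\<^sup>2"
    proof -
      have "a ^ (k + 2) * a ^ (2 * (k + 2) * (k + 3)) * a ^ (k + 4) * a ^ (4 * k + 14) = ?r\<^sup>2"
        unfolding power_add[symmetric] power_mult[symmetric]
        by (rule arg_cong[of _ _ "\<lambda>n. a ^ n"]) (simp add: algebra_simps)
      then have r: "?r\<^sup>2 / a ^ (4 * k + 14) = a ^ (k + 2) * a ^ (2 * (k + 2) * (k + 3)) * a ^ (k + 4)"
        using a by (simp add: field_simps)
      have "q\<^sup>2 * q ^ (k + 3) * q ^ (k + 3) = q ^ (2 * (k + 4))"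
        unfolding power_add[symmetric] by (rule arg_cong[of _ _ "\<lambda>n. q ^ n"]) simp
      moreover have "(4::real) ^ (k + 3) = 2 * 4 ^ (k + 2) * 2" by (simp add: eval_nat_numeral)
      moreover have "q\<^sup>2 * (a ^ (k + 2) * ?B2 * (2 * q ^ (k + 3) * a ^ (k + 4)))
          = (2 * 4 ^ (k + 2) * 2) * (q\<^sup>2 * q ^ (k + 3) * q ^ (k + 3))
            * (a ^ (k + 2) * a ^ (2 * (k + 2) * (k + 3)) * a ^ (k + 4))"
        by (simp only: mult_ac)
      ultimately show ?thesis by (simp only: r[symmetric] times_divide_eq_left times_divide_eq_right)
    qed
    finally show ?thesis using 3 by (simp add: rel_err_def algebra_simps)
  qed
qed

lemma relative_error_le:
  assumes d: "d \<ge> 2" and t: "t \<in> carrier R" "t \<noteq> \<zero>" and a: "a > 0" and q: "q \<le> a\<^sup>2"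
  shows "\<bar>real (det_count R d A t) / (a ^ (d * d) / q) - 1\<bar> \<le> real d ^ 2 * (q / a\<^sup>2) + sqrt (rel_err d q a)"
proof -
  have q0: "q > 0" using q_ge_2 by simp
  define N where "N = real (det_count R d A t)"
  define P where "P = a ^ (d * d)"
  define W where "W = a ^ (d - 2) * orth_moment d * (2 * q ^ d * a ^ d / q)"
  have P: "P > 0" using a by (simp add: P_def)
  have "sqrt (q\<^sup>2 * W) \<le> sqrt (rel_err d q a * P\<^sup>2)"
    unfolding W_def P_def by (intro real_sqrt_le_mono orth_moment_le_rel_err d a q)
  then have W: "q * sqrt W \<le> sqrt (rel_err d q a) * P"
    using P q0 by (simp add: real_sqrt_mult)
  have "\<bar>N - P / q\<bar> \<le> real d ^ 2 * P / a\<^sup>2 + sqrt W"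
    unfolding N_def P_def W_def by (rule det_count_error_le[OF d t a])
  then have "q * \<bar>N - P / q\<bar> \<le> q * (real d ^ 2 * P / a\<^sup>2 + sqrt W)"
    using q0 by (intro mult_left_mono) auto
  also have "\<dots> \<le> real d ^ 2 * (q / a\<^sup>2) * P + sqrt (rel_err d q a) * P"
    using W by (simp add: distrib_left mult_ac)
  finally have "q * \<bar>N - P / q\<bar> / P \<le> real d ^ 2 * (q / a\<^sup>2) + sqrt (rel_err d q a)"
    using P by (simp add: field_simps)
  moreover have "N / (P / q) - 1 = q * (N - P / q) / P" using P q0 by (simp add: field_simps)
  ultimately show ?thesis using P q0 unfolding N_def P_def by (simp add: abs_mult)
qed

end

section \<open>Limits and the asymptotic statement\<close>

lemma power_ratio_tendsto_0:
  fixes Q a :: "nat \<Rightarrow> real"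
  assumes lim: "(\<lambda>n. Q n powr \<theta> / a n) \<longlonglongrightarrow> 0" and Q: "\<And>n. Q n \<ge> 1" and a: "\<And>n. a n \<ge> 0"
    and s: "real s \<le> \<theta> * real k" and k: "k \<ge> 1"
  shows "(\<lambda>n. Q n ^ s / a n ^ k) \<longlonglongrightarrow> 0"
proof (rule tendsto_sandwich[OF _ _ tendsto_const])
  show "\<forall>\<^sub>F n in sequentially. 0 \<le> Q n ^ s / a n ^ k"
    using a Q by (intro always_eventually allI divide_nonneg_nonneg zero_le_power) (auto intro: order_trans[OF zero_le_one])
  show "\<forall>\<^sub>F n in sequentially. Q n ^ s / a n ^ k \<le> (Q n powr \<theta> / a n) ^ k"
  proof (intro always_eventually allI)
    fix n
    have q: "Q n > 0" using Q[of n] by simp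
    have "Q n ^ s = Q n powr real s" using q by (simp add: powr_realpow)
    also have "\<dots> \<le> Q n powr (\<theta> * real k)" using Q[of n] s by (intro powr_mono) auto
    also have "\<dots> = (Q n powr \<theta>) ^ k" using q by (simp add: powr_powr[symmetric] powr_realpow)
    finally show "Q n ^ s / a n ^ k \<le> (Q n powr \<theta> / a n) ^ k"
      using a[of n] by (simp add: power_divide divide_right_mono)
  qed
  show "(\<lambda>n. (Q n powr \<theta> / a n) ^ k) \<longlonglongrightarrow> 0"
    using tendsto_power[OF lim, of k] k by (simp only: zero_power)
qed

lemma rel_err_tendsto_0:
  fixes Q a :: "nat \<Rightarrow> real"
  assumes d: "d \<ge> 2"
    and l1: "(\<lambda>n. Q n powr (real d / (2 * real d - 1)) / a n) \<longlonglongrightarrow> 0"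
    and l2: "(\<lambda>n. Q n powr ((real d ^ 2 - real d + 4) / (2 * (real d ^ 2 - real d + 2))) / a n) \<longlonglongrightarrow> 0"
    and Q: "\<And>n. Q n \<ge> 1" and a: "\<And>n. a n \<ge> 0"
  shows "(\<lambda>n. rel_err d (Q n) (a n)) \<longlonglongrightarrow> 0"
proof -
  have first: "(\<lambda>n. Q n ^ 3 / a n ^ (d + 2)) \<longlonglongrightarrow> 0"
  proof (cases "d = 2")
    case True
    show ?thesis
      \<comment> \<open>At \<open>d = 2\<close> the second exponent is 3/4, which is exactly
        \<open>3 / (d + 2)\<close>.\<close>
      by (rule power_ratio_tendsto_0[OF l2 Q a]) (use True in auto)
  next
    case False
    then have d3: "real d \<ge> 3" using d by simp
    \<comment> \<open>Cross-multiplied, \<open>3 / (d + 2) \<le> d / (2 * d - 1)\<close> is this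
      inequality.\<close>
    have "0 \<le> (real d - 1) * (real d - 3)" using d3 by simp
    then have "real 3 \<le> real d / (2 * real d - 1) * real (d + 2)"
      using d3 by (simp add: field_simps)
    then show ?thesis by (intro power_ratio_tendsto_0[OF l1 Q a]) auto
  qed
  consider "d = 2" | "d = 3" | "d \<ge> 4" using d by linarith
  then have "(\<lambda>n. if d = 2 then 0 else if d = 3 then 352 * Q n ^ 5 / a n ^ 8
       else 4 ^ (d - 1) * Q n ^ (2 * d) / a n ^ (4 * d - 2)) \<longlonglongrightarrow> 0"
  proof cases
    case 2
    have "(\<lambda>n. Q n ^ 5 / a n ^ 8) \<longlonglongrightarrow> 0"
      \<comment> \<open>At \<open>d = 3\<close> the second exponent is exactly 5/8.\<close>
      by (rule power_ratio_tendsto_0[OF l2 Q a]) (use 2 in auto)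
    from tendsto_mult_right_zero[OF this, of 352] show ?thesis using 2 by simp
  next
    case 3
    have "real (4 * d - 2) = 2 * (2 * real d - 1)" using 3 by (simp add: of_nat_diff)
    then have "real (2 * d) \<le> real d / (2 * real d - 1) * real (4 * d - 2)"
      using 3 by (simp only:) (simp add: field_simps)
    then have "(\<lambda>n. Q n ^ (2 * d) / a n ^ (4 * d - 2)) \<longlonglongrightarrow> 0"
      using 3 by (intro power_ratio_tendsto_0[OF l1 Q a]) auto
    from tendsto_mult_right_zero[OF this, of "4 ^ (d - 1)"] show ?thesis using 3 by simp
  qed simp
  from tendsto_add[OF tendsto_mult_right_zero[OF first, of "2 ^ (d - 1)"] this]
  show ?thesis by (simp add: rel_err_def)
qed

text \<open>The limit runs along an arbitrary sequence of fields, sets and values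
  \<open>t n\<close>; as the choices are free for each \<open>n\<close>, this expresses uniformity
  in them.\<close>

theorem theorem4:
  fixes d :: nat
    and q :: "nat \<Rightarrow> nat"
    and F :: "nat \<Rightarrow> 'a ring"
    and A :: "nat \<Rightarrow> 'a set"
    and t :: "nat \<Rightarrow> 'a"
  assumes "d \<ge> 2"
    and "\<And>n. \<exists>p k. prime p \<and> odd p \<and> k \<ge> 1 \<and> q n = p ^ k"
    and "\<And>n. field (F n)"
    and "\<And>n. order (F n) = q n"
    and "\<And>n. t n \<in> carrier (F n) - {\<zero>\<^bsub>F n\<^esub>}"
    and "\<And>n. A n \<subseteq> carrier (F n)"
    and "filterlim q at_top sequentially"
    and "(\<lambda>n. real (card (A n))) \<in>
           \<omega>(\<lambda>n. real (q n) powr (real d / (2 * real d - 1)) +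
                 real (q n) powr ((real d ^ 2 - real d + 4) / (2 * (real d ^ 2 - real d + 2))))"
  shows "(\<lambda>n. real (det_count (F n) d (A n) (t n)))
           \<sim>[sequentially] (\<lambda>n. real (card (A n)) ^ (d ^ 2) / real (q n))"
proof -
  define Q where "Q n = real (q n)" for n
  define a where "a n = real (card (A n))" for n
  let ?\<alpha> = "real d / (2 * real d - 1)"
  let ?\<beta> = "(real d ^ 2 - real d + 4) / (2 * (real d ^ 2 - real d + 2))"
  let ?g = "\<lambda>n. Q n powr ?\<alpha> + Q n powr ?\<beta>"
  have qpos: "q n \<ge> 1" for n
  proof -
    obtain p k where "prime p" "q n = p ^ k" using assms(2) by blast
    then show ?thesis using prime_gt_0_nat[of p] by simp
  qed
  then have Q1: "Q n \<ge> 1" for n by (simp add: Q_def)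
  have a0: "a n \<ge> 0" for n by (simp add: a_def)
  have g: "?g \<in> o(a)"
    using assms(8) unfolding smallomega_iff_smallo Q_def a_def .
  have "(\<lambda>n. Q n powr ?\<alpha>) \<in> O(?g)" "(\<lambda>n. Q n powr ?\<beta>) \<in> O(?g)"
    by (intro landau_o.big_mono always_eventually allI; simp)+
  from this[THEN landau_o.big_small_trans[OF _ g], THEN smalloD_tendsto]
  have l1: "(\<lambda>n. Q n powr ?\<alpha> / a n) \<longlonglongrightarrow> 0" and l2: "(\<lambda>n. Q n powr ?\<beta> / a n) \<longlonglongrightarrow> 0" .
  have "\<forall>\<^sub>F n in sequentially. norm (?g n) \<le> 1 * norm (a n)"
    by (rule landau_o.smallD[OF g]) simp
  then have apos: "\<forall>\<^sub>F n in sequentially. a n > 0"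
  proof (rule eventually_mono)
    fix n
    assume elim: "norm (?g n) \<le> 1 * norm (a n)"
    have "Q n > 0" using Q1[of n] by simp
    then have "?g n > 0" by (intro add_pos_pos) (simp_all only: powr_gt_zero)
    then show "a n > 0" using elim a0[of n] by (simp only: real_norm_def)
  qed
  \<comment> \<open>The first exponent exceeds 1/2, so \<open>q / a\<^sup>2\<close> tends to zero.
    This settles the matrices with a vanishing cofactor and eventually gives
    \<open>q \<le> a\<^sup>2\<close>.\<close>
  have half: "1 \<le> ?\<alpha> * 2" using assms(1) by (simp add: field_simps)
  have l3: "(\<lambda>n. Q n ^ 1 / a n ^ 2) \<longlonglongrightarrow> 0"
    by (rule power_ratio_tendsto_0[OF l1 Q1 a0]) (use half in auto)
  have bound: "\<bar>real (det_count (F n) d (A n) (t n)) / (a n ^ (d ^ 2) / Q n) - 1\<bar>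
      \<le> real d ^ 2 * (Q n ^ 1 / (a n) ^ 2) + sqrt (rel_err d (Q n) (a n))"
    if "a n > 0" "Q n \<le> (a n)\<^sup>2" for n
  proof -
    have card: "card (carrier (F n)) = q n" using assms(4)[of n] by (simp add: order_def)
    \<comment> \<open>An infinite set has \<open>card\<close> zero, so a positive order yields
      finiteness.\<close>
    then have "finite (carrier (F n))" using qpos[of n] by (intro card_ge_0_finite) simp
    then interpret L: finite_field_subset "F n" "A n"
      using assms(3,6) by (intro finite_field_subset.intro finite_field_subset_axioms.intro)
    have "L.q = Q n" "L.a = a n"
      by (simp_all add: L.q_def L.a_def card Q_def a_def)
    then show ?thesis
      using L.relative_error_le[OF assms(1), of "t n"] assms(5)[of n] that
      by (simp add: power2_eq_square)
  qed
  have "(\<lambda>n. real d ^ 2 * (Q n ^ 1 / (a n) ^ 2) + sqrt (rel_err d (Q n) (a n))) \<longlonglongrightarrow> real d ^ 2 * 0 + sqrt 0"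
    by (intro tendsto_intros l3 rel_err_tendsto_0[OF assms(1) l1 l2 Q1 a0])
  then have lim: "(\<lambda>n. real d ^ 2 * (Q n ^ 1 / (a n) ^ 2) + sqrt (rel_err d (Q n) (a n))) \<longlonglongrightarrow> 0" by simp
  have "\<forall>\<^sub>F n in sequentially. Q n ^ 1 / a n ^ 2 < 1"
    by (rule order_tendstoD[OF l3]) simp
  then have le: "\<forall>\<^sub>F n in sequentially. norm (real (det_count (F n) d (A n) (t n)) / (a n ^ (d ^ 2) / Q n) - 1)
      \<le> real d ^ 2 * (Q n ^ 1 / (a n) ^ 2) + sqrt (rel_err d (Q n) (a n))"
    using apos
  proof eventually_elim
    case (elim n)
    then have "Q n \<le> (a n)\<^sup>2" by (simp add: pos_divide_less_eq)
    then show ?case using bound[of n] elim by (simp only: real_norm_def)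
  qed
  have "(\<lambda>n. real (det_count (F n) d (A n) (t n)) / (a n ^ (d ^ 2) / Q n) - 1) \<longlonglongrightarrow> 0"
    by (rule tendsto_0_le[OF lim, of _ 1]) (use le in \<open>auto elim!: eventually_mono\<close>)
  then have "(\<lambda>n. real (det_count (F n) d (A n) (t n)) / (a n ^ (d ^ 2) / Q n)) \<longlonglongrightarrow> 1"
    by (rule LIM_zero_cancel)
  then show ?thesis unfolding a_def Q_def by (rule asymp_equivI')
qed

end
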